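(* Let $d\le p$ and let $R$ be a unitarily invariant norm on $\mathbb{R}^{d\times p}$ with symmetric gauge $f$. Assume there exist $\eta_1,\eta_2\ge 0$ such that $f(\delta) \leq \max\{ \eta_1 \|\delta\|_1,\ \eta_2 \|\delta\|_2 \}$ for all $\delta \in \mathbb{R}^{d}$. Let $\Theta^*$ have rank $r$, and let $\theta^*\in\mathbb{R}^d$ be any subgradient of $f$ at $\sigma(\Theta^* )$ with nonnegative entries sorted in descending order; set $\rho = \theta^*_{\max}/\theta^*_{\min}$ (with $\rho=+\infty$ if $\theta^*_{\min}=0$). Then $$\Psi_R(\Theta^* ) \leq 2 \Phi_f(r) + \max\{ \eta_2,\ \eta_1 (1 + \rho) \sqrt{r} \},$$ where $\Phi_f(r) = \sup_{\delta\neq0,\ \|\delta\|_0 \leq r} f(\delta)/\|\delta\|_2$.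
   Context: A norm $R$ on $\mathbb{R}^{d\times p}$ is unitarily invariant if $R(U\Theta V)=R(\Theta)$ for all orthogonal $U, V$ of appropriate sizes; then $R(\Theta)=f(\sigma(\Theta))$ for a symmetric gauge function $f$ on $\mathbb{R}^d$ (a permutation- and sign-invariant norm), with $\sigma(\Theta)\in\mathbb{R}^d$ the singular values of $\Theta$ sorted in descending order. $\theta^*_{\max}$ and $\theta^*_{\min}$ are the largest and smallest entries of $\theta^*$. $\mathcal{E}_R(\Theta^* ) = \mathrm{cone}\{ \Delta : R(\Delta + \Theta^* ) \leq R(\Theta^* ) \}$ and $\Psi_{R}(\Theta^* ) = \sup_{\Delta \in \mathcal{E}_R(\Theta^* )\setminus\{0\}} R(\Delta)/\|\Delta\|_{F}$. *)

theory Defs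
  imports "HOL-Analysis.Analysis" "HOL-Library.Extended_Real" "Jordan_Normal_Form.DL_Rank"
begin

definition orth_mat :: "nat \<Rightarrow> real mat \<Rightarrow> bool" where
  "orth_mat n U \<longleftrightarrow> U \<in> carrier_mat n n \<and> transpose_mat U * U = 1\<^sub>m n"

definition vec_norm_on :: "nat \<Rightarrow> (real vec \<Rightarrow> real) \<Rightarrow> bool" where
  "vec_norm_on d f \<longleftrightarrow> (\<forall>x\<in>carrier_vec d. \<forall>y\<in>carrier_vec d. \<forall>c::real.
      0 \<le> f x \<and> (f x = 0 \<longleftrightarrow> x = 0\<^sub>v d) \<and> f (c \<cdot>\<^sub>v x) = \<bar>c\<bar> * f x \<and> f (x + y) \<le> f x + f y)"

definition mat_norm_on :: "nat \<Rightarrow> nat \<Rightarrow> (real mat \<Rightarrow> real) \<Rightarrow> bool" where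
  "mat_norm_on d p R \<longleftrightarrow> (\<forall>X\<in>carrier_mat d p. \<forall>Y\<in>carrier_mat d p. \<forall>c::real.
      0 \<le> R X \<and> (R X = 0 \<longleftrightarrow> X = 0\<^sub>m d p) \<and> R (c \<cdot>\<^sub>m X) = \<bar>c\<bar> * R X \<and> R (X + Y) \<le> R X + R Y)"

definition unitarily_invariant :: "nat \<Rightarrow> nat \<Rightarrow> (real mat \<Rightarrow> real) \<Rightarrow> bool" where
  "unitarily_invariant d p R \<longleftrightarrow>
     (\<forall>X\<in>carrier_mat d p. \<forall>U V. orth_mat d U \<longrightarrow> orth_mat p V \<longrightarrow> R (U * X * V) = R X)"

definition symmetric_gauge :: "nat \<Rightarrow> (real vec \<Rightarrow> real) \<Rightarrow> bool" where
  "symmetric_gauge d f \<longleftrightarrow> vec_norm_on d f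
     \<and> (\<forall>x\<in>carrier_vec d. \<forall>\<pi>. \<pi> permutes {..<d} \<longrightarrow> f (vec d (\<lambda>i. x $ \<pi> i)) = f x)
     \<and> (\<forall>x\<in>carrier_vec d. \<forall>s::nat \<Rightarrow> real. (\<forall>i<d. s i = 1 \<or> s i = -1)
           \<longrightarrow> f (vec d (\<lambda>i. s i * x $ i)) = f x)"

definition rect_diag :: "nat \<Rightarrow> nat \<Rightarrow> real vec \<Rightarrow> real mat" where
  "rect_diag d p s = mat d p (\<lambda>(i,j). if i = j then s $ i else 0)"

definition is_sing_vals :: "nat \<Rightarrow> nat \<Rightarrow> real mat \<Rightarrow> real vec \<Rightarrow> bool" where
  "is_sing_vals d p X s \<longleftrightarrow> s \<in> carrier_vec d \<and> (\<forall>i<d. 0 \<le> s $ i)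
     \<and> (\<forall>i j. i \<le> j \<longrightarrow> j < d \<longrightarrow> s $ j \<le> s $ i)
     \<and> (\<exists>U V. orth_mat d U \<and> orth_mat p V \<and> X = U * rect_diag d p s * V)"

definition sing_vals :: "nat \<Rightarrow> nat \<Rightarrow> real mat \<Rightarrow> real vec" where
  "sing_vals d p X = (THE s. is_sing_vals d p X s)"

definition is_subgradient :: "nat \<Rightarrow> (real vec \<Rightarrow> real) \<Rightarrow> real vec \<Rightarrow> real vec \<Rightarrow> bool" where
  "is_subgradient d f x g \<longleftrightarrow> g \<in> carrier_vec d \<and>
     (\<forall>y\<in>carrier_vec d. f y \<ge> f x + g \<bullet> (y - x))"

definition l0_norm :: "real vec \<Rightarrow> nat" where
  "l0_norm x = card {i. i < dim_vec x \<and> x $ i \<noteq> 0}"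

definition l1_norm :: "real vec \<Rightarrow> real" where
  "l1_norm x = (\<Sum>i<dim_vec x. \<bar>x $ i\<bar>)"

definition l2_norm :: "real vec \<Rightarrow> real" where
  "l2_norm x = sqrt (\<Sum>i<dim_vec x. (x $ i)\<^sup>2)"

definition frob_norm :: "real mat \<Rightarrow> real" where
  "frob_norm X = sqrt (\<Sum>i<dim_row X. \<Sum>j<dim_col X. (X $$ (i,j))\<^sup>2)"

definition Phi_f :: "nat \<Rightarrow> (real vec \<Rightarrow> real) \<Rightarrow> nat \<Rightarrow> ereal" where
  "Phi_f d f r = Sup {ereal (f \<delta> / l2_norm \<delta>) | \<delta>.
       \<delta> \<in> carrier_vec d \<and> \<delta> \<noteq> 0\<^sub>v d \<and> l0_norm \<delta> \<le> r}"

definition err_cone :: "nat \<Rightarrow> nat \<Rightarrow> (real mat \<Rightarrow> real) \<Rightarrow> real mat \<Rightarrow> real mat set" where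
  "err_cone d p R Ts = {t \<cdot>\<^sub>m D | t D. 0 \<le> t \<and> D \<in> carrier_mat d p \<and> R (D + Ts) \<le> R Ts}"

definition Psi_R :: "nat \<Rightarrow> nat \<Rightarrow> (real mat \<Rightarrow> real) \<Rightarrow> real mat \<Rightarrow> ereal" where
  "Psi_R d p R Ts = Sup {ereal (R D / frob_norm D) | D. D \<in> err_cone d p R Ts \<and> D \<noteq> 0\<^sub>m d p}"

definition vmax :: "nat \<Rightarrow> real vec \<Rightarrow> real" where
  "vmax d v = Max {v $ i | i. i < d}"

definition vmin :: "nat \<Rightarrow> real vec \<Rightarrow> real" where
  "vmin d v = Min {v $ i | i. i < d}"

definition rho_ratio :: "nat \<Rightarrow> real vec \<Rightarrow> ereal" where
  "rho_ratio d v = (if vmin d v = 0 then \<infinity> else ereal (vmax d v / vmin d v))"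

end

theory Submission
  imports Defs "Jordan_Normal_Form.Char_Poly"
begin

text \<open>
  Choose orthogonal coordinates in which \<open>Ts\<close> is the diagonal matrix \<open>S\<close> of its singular values, supported
  in the leading \<open>r \<times> r\<close> block, and in which moreover the complementary block \<open>E\<close> of the error \<open>\<Delta>\<close> (rows
  and columns from \<open>r\<close> on) is diagonal and nonnegative; the rotations diagonalising \<open>E\<close> fix \<open>S\<close>. Removing
  the off-diagonal entries of \<open>S + \<Delta>\<close> does not increase \<open>R\<close>, so the subgradient inequality for \<open>f\<close>, applied
  to the diagonal, gives \<open>\<Sum> \<theta>\<^sub>i \<Delta>\<^sub>i\<^sub>i \<le> 0\<close> without any appeal to von Neumann's trace inequality. By
  Cauchy--Schwarz this yields \<open>\<theta>\<^sub>m\<^sub>i\<^sub>n \<parallel>diag E\<parallel>\<^sub>1 \<le> \<theta>\<^sub>m\<^sub>a\<^sub>x \<surd>r \<parallel>\<Delta>\<parallel>\<^sub>F\<close>, which bounds \<open>R E = f (diag E)\<close>. The rest of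
  \<open>\<Delta>\<close> is the sum of a matrix with \<open>r\<close> rows and one with \<open>r\<close> columns, each of norm at most \<open>\<Phi>\<^sub>f(r) \<parallel>\<Delta>\<parallel>\<^sub>F\<close>.
\<close>

no_notation vec_nth (infixl "$" 90)
no_notation inner (infix "\<bullet>" 70)

subsection \<open>Orthogonal matrices acting on a block of coordinates\<close>

text \<open>A rotation of the coordinates from \<open>k\<close> to \<open>a - 1\<close> is kept as a
  full \<open>n\<close> by \<open>n\<close> matrix, so that recursion on ever smaller blocks never
  changes the dimension.\<close>

definition orth_on :: "nat \<Rightarrow> nat \<Rightarrow> nat \<Rightarrow> real mat \<Rightarrow> bool" where
  "orth_on n k a U \<longleftrightarrow> orth_mat n U \<and>
     (\<forall>i<n. \<forall>j<n. i \<notin> {k..<a} \<or> j \<notin> {k..<a} \<longrightarrow> U $$ (i,j) = (if i = j then 1 else 0))"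

definition unit_on :: "nat \<Rightarrow> nat \<Rightarrow> nat \<Rightarrow> real vec set" where
  "unit_on n k a = {u \<in> carrier_vec n. u \<bullet> u = 1 \<and> (\<forall>i<n. i \<notin> {k..<a} \<longrightarrow> u $ i = 0)}"

lemma orth_mat_carrier: "orth_mat n U \<Longrightarrow> U \<in> carrier_mat n n"
  by (simp add: orth_mat_def)

lemma orth_mat_transpose_mult: "orth_mat n U \<Longrightarrow> transpose_mat U * U = 1\<^sub>m n"
  by (simp add: orth_mat_def)

lemma orth_mat_mult_transpose: "orth_mat n U \<Longrightarrow> U * transpose_mat U = 1\<^sub>m n"
  unfolding orth_mat_def using mat_mult_left_right_inverse[of "transpose_mat U" n U] by auto

lemma orth_mat_transpose: "orth_mat n U \<Longrightarrow> orth_mat n (transpose_mat U)"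
  using orth_mat_mult_transpose[of n U] by (auto simp: orth_mat_def)

lemma orth_mat_mult:
  assumes "orth_mat n U" "orth_mat n V"
  shows "orth_mat n (U * V)"
proof -
  note c = assms[THEN orth_mat_carrier]
  have "transpose_mat (U * V) * (U * V) = transpose_mat V * ((transpose_mat U * U) * V)"
    using c by (simp add: transpose_mult[OF c] assoc_mult_mat[of _ n n _ n _ n])
  then show ?thesis
    using c assms[THEN orth_mat_transpose_mult] by (simp add: orth_mat_def)
qed

lemma orth_mat_cancel:
  assumes U: "orth_mat d U" and V: "orth_mat p V" and X: "X \<in> carrier_mat d p"
  shows "transpose_mat U * (U * X * V) * transpose_mat V = X"
proof -
  note c = U[THEN orth_mat_carrier] V[THEN orth_mat_carrier]
  have "transpose_mat U * (U * X * V) * transpose_mat V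
      = (transpose_mat U * U) * X * (V * transpose_mat V)"
    using c X by (simp add: assoc_mult_mat[of _ d d _ p _ p] assoc_mult_mat[of _ d d _ d _ p]
        assoc_mult_mat[of _ d p _ p _ p])
  then show ?thesis
    using X orth_mat_transpose_mult[OF U] orth_mat_mult_transpose[OF V] by simp
qed

lemma orth_mat_scalar_prod:
  assumes "orth_mat n U" "x \<in> carrier_vec n" "y \<in> carrier_vec n"
  shows "(U *\<^sub>v x) \<bullet> (U *\<^sub>v y) = x \<bullet> y"
proof -
  note c = assms(1)[THEN orth_mat_carrier]
  have "(U *\<^sub>v x) \<bullet> (U *\<^sub>v y) = (transpose_mat (transpose_mat U) *\<^sub>v x) \<bullet> (U *\<^sub>v y)"
    by simp
  also have "\<dots> = x \<bullet> (transpose_mat U *\<^sub>v (U *\<^sub>v y))"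
    using c assms by (intro transpose_vec_mult_scalar[of _ n n]) auto
  also have "transpose_mat U *\<^sub>v (U *\<^sub>v y) = (transpose_mat U * U) *\<^sub>v y"
    using c assms by simp
  finally show ?thesis using assms by (simp add: orth_mat_transpose_mult[OF assms(1)])
qed

lemma orth_on_orth: "orth_on n k a U \<Longrightarrow> orth_mat n U"
  by (simp add: orth_on_def)

lemma orth_on_entry:
  "orth_on n k a U \<Longrightarrow> i < n \<Longrightarrow> j < n \<Longrightarrow> i \<notin> {k..<a} \<or> j \<notin> {k..<a}
    \<Longrightarrow> U $$ (i,j) = (if i = j then 1 else 0)"
  by (simp add: orth_on_def)

lemma orth_on_transpose: "orth_on n k a U \<Longrightarrow> orth_on n k a (transpose_mat U)"
  using orth_mat_transpose[of n U] orth_mat_carrier[of n U]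
  by (auto simp: orth_on_def)

lemma orth_on_mono:
  assumes "orth_on n k a U" "k' \<le> k" "a \<le> a'"
  shows "orth_on n k' a' U"
  using assms by (auto simp: orth_on_def)

lemma orth_on_one: "orth_on n k a (1\<^sub>m n)"
  by (auto simp: orth_on_def orth_mat_def)

lemma index_mult_mat_sum:
  assumes "A \<in> carrier_mat m n" "B \<in> carrier_mat n q" "i < m" "j < q"
  shows "(A * B) $$ (i,j) = (\<Sum>l<n. A $$ (i,l) * B $$ (l,j))"
  using assms by (auto simp: scalar_prod_def atLeast0LessThan intro!: sum.cong)

lemma orth_on_mult_left:
  assumes U: "orth_on n k a U" and X: "X \<in> carrier_mat n q"
    and i: "i < n" "j < q" "i \<notin> {k..<a}"
  shows "(U * X) $$ (i,j) = X $$ (i,j)"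
proof -
  have "(U * X) $$ (i,j) = (\<Sum>l<n. U $$ (i,l) * X $$ (l,j))"
    using orth_mat_carrier[OF orth_on_orth[OF U]] X i by (intro index_mult_mat_sum)
  also have "\<dots> = (\<Sum>l<n. if i = l then X $$ (l,j) else 0)"
    using orth_on_entry[OF U i(1)] i by (intro sum.cong) auto
  finally show ?thesis using i by simp
qed

lemma orth_on_mult_right:
  assumes U: "orth_on n k a U" and X: "X \<in> carrier_mat q n"
    and i: "i < q" "j < n" "j \<notin> {k..<a}"
  shows "(X * U) $$ (i,j) = X $$ (i,j)"
proof -
  have "(X * U) $$ (i,j) = (\<Sum>l<n. X $$ (i,l) * U $$ (l,j))"
    using orth_mat_carrier[OF orth_on_orth[OF U]] X i by (intro index_mult_mat_sum)
  also have "\<dots> = (\<Sum>l<n. if l = j then X $$ (i,l) else 0)"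
    using orth_on_entry[OF U _ i(2)] i by (intro sum.cong) auto
  finally show ?thesis using i by simp
qed

lemma orth_on_mult:
  assumes U: "orth_on n k a U" and V: "orth_on n k a V"
  shows "orth_on n k a (U * V)"
  unfolding orth_on_def
proof (intro conjI allI impI)
  show "orth_mat n (U * V)"
    using assms by (intro orth_mat_mult orth_on_orth)
  note c = U[THEN orth_on_orth, THEN orth_mat_carrier] V[THEN orth_on_orth, THEN orth_mat_carrier]
  fix i j assume ij: "i < n" "j < n" "i \<notin> {k..<a} \<or> j \<notin> {k..<a}"
  show "(U * V) $$ (i,j) = (if i = j then 1 else 0)"
  proof (cases "i \<in> {k..<a}")
    case False
    then show ?thesis
      using orth_on_mult_left[OF U c(2) ij(1,2) False] orth_on_entry[OF V ij(1,2)] by simp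
  next
    case True
    then have j: "j \<notin> {k..<a}" using ij by simp
    then show ?thesis
      using orth_on_mult_right[OF V c(1) ij(1,2) j] orth_on_entry[OF U ij(1,2)] by simp
  qed
qed

lemma orth_on_unit_on:
  assumes U: "orth_on n k a U" and u: "u \<in> unit_on n k a"
  shows "U *\<^sub>v u \<in> unit_on n k a"
proof -
  note c = U[THEN orth_on_orth, THEN orth_mat_carrier]
  have uc: "u \<in> carrier_vec n" using u by (simp add: unit_on_def)
  have "(U *\<^sub>v u) $ i = 0" if i: "i < n" "i \<notin> {k..<a}" for i
  proof -
    have "(U *\<^sub>v u) $ i = (\<Sum>l<n. U $$ (i,l) * u $ l)"
      using c uc i by (auto simp: scalar_prod_def atLeast0LessThan intro!: sum.cong)
    also have "\<dots> = 0"
      using orth_on_entry[OF U i(1)] i u by (intro sum.neutral) (auto simp: unit_on_def)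
    finally show ?thesis .
  qed
  then show ?thesis
    using orth_mat_scalar_prod[OF orth_on_orth[OF U] uc uc] c uc u by (auto simp: unit_on_def)
qed

lemma unit_on_unit_vec: "k \<le> i \<Longrightarrow> i < a \<Longrightarrow> i < n \<Longrightarrow> unit_vec n i \<in> unit_on n k a"
  by (auto simp: unit_on_def)

subsection \<open>Singular value decomposition\<close>

text \<open>The sphere is taken among functions on \<open>nat\<close> with the product topology,
  where it is a closed subset of the Tychonoff cube with sides \<open>{-1..1}\<close>.\<close>

lemma compact_unit_sphere_fun:
  fixes A :: "nat set"
  assumes "finite A"
  shows "compact {u::nat \<Rightarrow> real. (\<forall>i. i \<notin> A \<longrightarrow> u i = 0) \<and> (\<Sum>i\<in>A. (u i)\<^sup>2) = 1}"
    (is "compact ?K")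
proof -
  have comp: "compact (PiE UNIV (\<lambda>i::nat. {-1..1::real}))"
    using compactin_PiE[of "\<lambda>i::nat. euclidean :: real topology" UNIV "\<lambda>i. {-1..1}"]
    by (simp add: euclidean_product_topology)
  have "closed {u::nat \<Rightarrow> real. (\<Sum>i\<in>A. (u i)\<^sup>2) = 1}"
    by (intro closed_Collect_eq continuous_intros) auto
  moreover have "closed {u::nat \<Rightarrow> real. \<forall>i. i \<notin> A \<longrightarrow> u i = 0}"
    by (intro closed_Collect_all closed_Collect_imp closed_Collect_eq open_Collect_const
        continuous_on_product_coordinates continuous_on_const)
  ultimately have closed: "closed ?K"
    by (simp add: Collect_conj_eq closed_Int)
  have "?K \<subseteq> PiE UNIV (\<lambda>i::nat. {-1..1::real})"
  proof
    fix u assume u: "u \<in> ?K"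
    have "\<bar>u i\<bar> \<le> 1" for i
    proof (cases "i \<in> A")
      case True
      then have "(u i)\<^sup>2 \<le> (\<Sum>i\<in>A. (u i)\<^sup>2)" using assms by (intro member_le_sum) auto
      then show ?thesis using u by (simp add: abs_square_le_1)
    qed (use u in auto)
    then show "u \<in> PiE UNIV (\<lambda>i::nat. {-1..1::real})" by (auto simp: abs_le_iff minus_le_iff)
  qed
  then have "PiE UNIV (\<lambda>i::nat. {-1..1::real}) \<inter> ?K = ?K" by (rule Int_absorb1)
  then show ?thesis using compact_Int_closed[OF comp closed] by (simp only:)
qed

text \<open>The maximum is the largest singular value of the block. The form is a finite sum of
  products of coordinates, hence continuous on the product of two compact spheres.\<close>

lemma bilinear_form_attains_max:
  assumes X: "X \<in> carrier_mat d p"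
    and k: "k < a" "a \<le> d" "k < b" "b \<le> p"
  obtains u v where "u \<in> unit_on d k a" "v \<in> unit_on p k b"
    "\<And>u' v'. u' \<in> unit_on d k a \<Longrightarrow> v' \<in> unit_on p k b \<Longrightarrow> u' \<bullet> (X *\<^sub>v v') \<le> u \<bullet> (X *\<^sub>v v)"
proof -
  define K where "K A = {u::nat \<Rightarrow> real. (\<forall>i. i \<notin> A \<longrightarrow> u i = 0) \<and> (\<Sum>i\<in>A. (u i)\<^sup>2) = 1}" for A
  define F where "F w = (\<Sum>i<d. \<Sum>j<p. fst w i * X $$ (i,j) * snd w j)" for w :: "(nat \<Rightarrow> real) \<times> (nat \<Rightarrow> real)"
  have comp: "compact (K {k..<a} \<times> K {k..<b})"
    unfolding K_def by (intro compact_Times compact_unit_sphere_fun) auto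
  have coord: "continuous_on S (\<lambda>w. fst w i)" "continuous_on S (\<lambda>w. snd w i)"
    for S :: "((nat \<Rightarrow> real) \<times> (nat \<Rightarrow> real)) set" and i
    using continuous_on_compose2[OF continuous_on_product_coordinates[of i]
        continuous_on_fst[OF continuous_on_id[of S]]]
      continuous_on_compose2[OF continuous_on_product_coordinates[of i]
        continuous_on_snd[OF continuous_on_id[of S]]] by simp_all
  have "continuous_on (K {k..<a} \<times> K {k..<b}) F"
    unfolding F_def by (intro continuous_intros coord)
  moreover have "(\<lambda>i. if i = k then 1 else 0) \<in> K {k..<a}" if "k < a" for a
  proof -
    have "(\<Sum>i\<in>{k..<a}. (if i = k then 1 else 0 :: real)\<^sup>2) = (\<Sum>i\<in>{k..<a}. if i = k then 1 else 0)"
      by (intro sum.cong) auto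
    then show ?thesis using that by (auto simp: K_def)
  qed
  then have "K {k..<a} \<times> K {k..<b} \<noteq> {}" using k by blast
  ultimately obtain w where w: "w \<in> K {k..<a} \<times> K {k..<b}"
    and max: "\<And>w'. w' \<in> K {k..<a} \<times> K {k..<b} \<Longrightarrow> F w' \<le> F w"
    using continuous_attains_sup[OF comp] by blast
  have F: "F (\<lambda>i. if i < d then u $ i else 0, \<lambda>i. if i < p then v $ i else 0) = u \<bullet> (X *\<^sub>v v)"
    if "u \<in> carrier_vec d" "v \<in> carrier_vec p" for u v
    using that X by (auto simp: F_def scalar_prod_def atLeast0LessThan sum_distrib_left mult.assoc
        intro!: sum.cong)
  \<comment> \<open>\<open>to\<close> and \<open>fro\<close> translate between unit vectors and
    functions extended by zero.\<close>
  have to: "(\<lambda>i. if i < n then u $ i else 0) \<in> K {k..<a}" if "u \<in> unit_on n k a" "a \<le> n" for n a u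
  proof -
    have "(\<Sum>i\<in>{k..<a}. (if i < n then u $ i else 0)\<^sup>2) = (\<Sum>i\<in>{0..<n}. u $ i * u $ i)"
      using that by (intro sum.mono_neutral_cong_left) (auto simp: unit_on_def power2_eq_square)
    also have "\<dots> = u \<bullet> u" using that by (auto simp: unit_on_def scalar_prod_def)
    finally show ?thesis using that by (auto simp: K_def unit_on_def)
  qed
  have fro: "vec n u \<in> unit_on n k a" if "u \<in> K {k..<a}" "a \<le> n" for n a u
  proof -
    have "vec n u \<bullet> vec n u = (\<Sum>i\<in>{0..<n}. (u i)\<^sup>2)"
      by (simp add: scalar_prod_def power2_eq_square)
    also have "\<dots> = (\<Sum>i\<in>{k..<a}. (u i)\<^sup>2)"
      using that by (intro sum.mono_neutral_cong_right) (auto simp: K_def)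
    finally show ?thesis using that by (auto simp: K_def unit_on_def)
  qed
  let ?u = "vec d (fst w)" and ?v = "vec p (snd w)"
  have "F w = F (\<lambda>i. if i < d then ?u $ i else 0, \<lambda>i. if i < p then ?v $ i else 0)"
    by (simp add: F_def)
  then have Fw: "F w = ?u \<bullet> (X *\<^sub>v ?v)" using F[of ?u ?v] by simp
  show thesis
  proof (rule that[of ?u ?v])
    show "?u \<in> unit_on d k a" "?v \<in> unit_on p k b" using w k fro by auto
    fix u' v' assume uv: "u' \<in> unit_on d k a" "v' \<in> unit_on p k b"
    then have "u' \<bullet> (X *\<^sub>v v') \<le> F w"
      using max[of "(\<lambda>i. if i < d then u' $ i else 0, \<lambda>i. if i < p then v' $ i else 0)"]
        to[OF uv(1) k(2)] to[OF uv(2) k(4)] F[of u' v'] by (auto simp: unit_on_def)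
    then show "u' \<bullet> (X *\<^sub>v v') \<le> ?u \<bullet> (X *\<^sub>v ?v)" using Fw by simp
  qed
qed

text \<open>
  For \<open>u = e\<^sub>k\<close> the vector \<open>w\<close> vanishes and \<open>c = 2 / 0 = 0\<close>, so that the reflection degenerates to the
  identity, as it should.
\<close>

lemma householder:
  assumes u: "u \<in> unit_on n k a" and k: "k < a" "a \<le> n"
  obtains H where "orth_on n k a H" "H *\<^sub>v unit_vec n k = u"
proof -
  define w where "w i = (if i = k then 1 else 0) - u $ i" for i
  define c where "c = 2 / (\<Sum>l<n. (w l)\<^sup>2)"
  define H where "H = mat n n (\<lambda>(i,j). (if i = j then 1 else 0) - c * w i * w j)"
  have uu: "(\<Sum>l<n. (u $ l)\<^sup>2) = 1"
    using u by (auto simp: unit_on_def scalar_prod_def power2_eq_square atLeast0LessThan)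
  have w0: "w i = 0" if "i < n" "i \<notin> {k..<a}" for i
    using that u k by (auto simp: w_def unit_on_def)
  have "(\<Sum>l<n. (w l)\<^sup>2) = (\<Sum>l<n. (if l = k then 1 - 2 * u $ k else 0) + (u $ l)\<^sup>2)"
    by (intro sum.cong) (auto simp: w_def power2_eq_square algebra_simps)
  also have "\<dots> = 2 * (1 - u $ k)" using k by (simp add: sum.distrib uu)
  finally have ww: "(\<Sum>l<n. (w l)\<^sup>2) = 2 * (1 - u $ k)" .
  have wk: "w k = 1 - u $ k" by (simp add: w_def)
  \<comment> \<open>If \<open>u\<close> already has leading entry \<open>1\<close>, then
    \<open>w\<close> vanishes; otherwise the denominator of \<open>c\<close> is nonzero. The next
    two facts carry a factor \<open>w i\<close> so that they hold in both cases.\<close>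
  have null: "w i = 0" if "u $ k = 1" "i < n" for i
    using ww that by (simp add: sum_nonneg_eq_0_iff)
  have cw: "c * (\<Sum>l<n. (w l)\<^sup>2) * w i = 2 * w i" if "i < n" for i
    using null[OF _ that] ww by (cases "u $ k = 1") (auto simp: c_def field_simps)
  have ck: "c * w k * w i = w i" if "i < n" for i
    using null[OF _ that] by (cases "u $ k = 1") (auto simp: c_def ww wk)
  have "transpose_mat H * H = 1\<^sub>m n"
  proof (rule eq_matI)
    fix i j assume "i < dim_row (1\<^sub>m n :: real mat)" "j < dim_col (1\<^sub>m n :: real mat)"
    then have ij: "i < n" "j < n" by auto
    have "(transpose_mat H * H) $$ (i,j)
       = (\<Sum>l<n. ((if l = i then 1 else 0) - c * w l * w i) * ((if l = j then 1 else 0) - c * w l * w j))"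
      using ij by (subst index_mult_mat_sum[of _ n n _ n]) (auto simp: H_def)
    also have "\<dots> = (\<Sum>l<n. (if l = i then (if i = j then 1 else 0) - c * w i * w j else 0)
        - (if l = j then c * w i * w j else 0) + c * w i * w j * c * (w l)\<^sup>2)"
      by (intro sum.cong) (auto simp: power2_eq_square algebra_simps)
    also have "\<dots> = (if i = j then 1 else 0) - 2 * (c * w i * w j) + c * w i * (c * (\<Sum>l<n. (w l)\<^sup>2) * w j)"
      using ij by (simp add: sum.distrib sum_subtractf sum_distrib_left[symmetric] algebra_simps)
    also have "\<dots> = (if i = j then 1 else 0)" by (simp add: cw[OF ij(2)])
    finally show "(transpose_mat H * H) $$ (i,j) = 1\<^sub>m n $$ (i,j)" using ij by simp
  qed (auto simp: H_def)
  then have "orth_on n k a H"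
    using w0 by (auto simp: orth_on_def orth_mat_def H_def)
  moreover have "H *\<^sub>v unit_vec n k = u"
  proof (rule eq_vecI)
    fix i assume "i < dim_vec u"
    then have i: "i < n" using u by (auto simp: unit_on_def)
    have "(H *\<^sub>v unit_vec n k) $ i = H $$ (i,k)"
      using i k by (simp add: H_def)
    also have "\<dots> = (if i = k then 1 else 0) - c * w k * w i" using i k by (simp add: H_def)
    also have "\<dots> = u $ i" unfolding ck[OF i] by (simp add: w_def)
    finally show "(H *\<^sub>v unit_vec n k) $ i = u $ i" .
  qed (use u in \<open>auto simp: unit_on_def H_def\<close>)
  ultimately show thesis using that by blast
qed

section \<open>Greedy diagonalisation of a block\<close>

lemma index_mat_bilinear:
  fixes Y :: "real mat"
  assumes "Y \<in> carrier_mat d p" "i < d" "j < p"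
  shows "unit_vec d i \<bullet> (Y *\<^sub>v unit_vec p j) = Y $$ (i,j)"
  using assms by simp

lemma orth_mat_bilinear:
  assumes U: "orth_mat d U" and V: "orth_mat p V" and X: "X \<in> carrier_mat d p"
    and u: "u \<in> carrier_vec d" and v: "v \<in> carrier_vec p"
  shows "u \<bullet> ((U * X * V) *\<^sub>v v) = (transpose_mat U *\<^sub>v u) \<bullet> (X *\<^sub>v (V *\<^sub>v v))"
proof -
  note c = U[THEN orth_mat_carrier] V[THEN orth_mat_carrier]
  have "(U * X * V) *\<^sub>v v = U *\<^sub>v (X *\<^sub>v (V *\<^sub>v v))"
    using c X v by (simp add: assoc_mult_mat_vec[of _ d p _ p] assoc_mult_mat_vec[of _ d d _ p])
  then show ?thesis
    using transpose_vec_mult_scalar[OF c(1) _ u, of "X *\<^sub>v (V *\<^sub>v v)"] X c v by auto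
qed

definition diag_block :: "nat \<Rightarrow> nat \<Rightarrow> nat \<Rightarrow> real mat \<Rightarrow> bool" where
  "diag_block k a b Y \<longleftrightarrow>
     (\<forall>i j. k \<le> i \<longrightarrow> i < a \<longrightarrow> k \<le> j \<longrightarrow> j < b \<longrightarrow> i \<noteq> j \<longrightarrow> Y $$ (i,j) = 0) \<and>
     (\<forall>i. k \<le> i \<longrightarrow> i < a \<longrightarrow> i < b \<longrightarrow> 0 \<le> Y $$ (i,i)) \<and>
     (\<forall>i j. k \<le> i \<longrightarrow> i \<le> j \<longrightarrow> j < a \<longrightarrow> j < b \<longrightarrow> Y $$ (j,j) \<le> Y $$ (i,i))"

lemma unit_on_D:
  assumes "u \<in> unit_on n k a"
  shows "u \<in> carrier_vec n" "u \<bullet> u = 1" "\<And>i. i < n \<Longrightarrow> i \<notin> {k..<a} \<Longrightarrow> u $ i = 0"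
  using assms by (auto simp: unit_on_def)

lemma unit_on_uminus: "u \<in> unit_on n k a \<Longrightarrow> - u \<in> unit_on n k a"
  by (auto simp: unit_on_def)

text \<open>
  If the leading entry of \<open>w\<close> is the maximum of \<open>u \<bullet> w\<close> over unit vectors, it is the norm of \<open>w\<close>.
\<close>

lemma dominated_by_leading_entry:
  fixes w :: "real vec"
  assumes w: "w \<in> carrier_vec n" and k: "k < a" "a \<le> n"
    and le: "\<And>u. u \<in> unit_on n k a \<Longrightarrow> u \<bullet> w \<le> w $ k"
    and i: "k < i" "i < a"
  shows "w $ i = 0"
proof -
  define N where "N = (\<Sum>l\<in>{k..<a}. (w $ l)\<^sup>2)"
  have N0: "0 \<le> N" by (simp add: N_def sum_nonneg)
  have wk: "0 \<le> w $ k"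
  proof -
    have "- (unit_vec n k \<bullet> w) \<le> w $ k"
      using le[OF unit_on_uminus[OF unit_on_unit_vec[of k k]]] k w by simp
    then show ?thesis using k w by simp
  qed
  have "N \<le> (w $ k)\<^sup>2"
  proof (cases "N = 0")
    case False
    then have N: "0 < N" using N0 by simp
    \<comment> \<open>The test vector is the block part of \<open>w\<close>, normalised; its product
      with \<open>w\<close> is the norm of that part.\<close>
    define u where "u = vec n (\<lambda>l. if l \<in> {k..<a} then w $ l / sqrt N else 0)"
    have "u \<bullet> u = (\<Sum>l\<in>{0..<n}. u $ l * u $ l)"
      by (simp add: scalar_prod_def u_def)
    also have "\<dots> = (\<Sum>l\<in>{k..<a}. (w $ l)\<^sup>2 / N)"
      using k N by (intro sum.mono_neutral_cong_right) (auto simp: u_def power2_eq_square)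
    also have "\<dots> = 1" using N by (simp add: sum_divide_distrib[symmetric] N_def[symmetric])
    finally have "u \<in> unit_on n k a" by (auto simp: unit_on_def u_def)
    moreover have "u \<bullet> w = sqrt N"
    proof -
      have "u \<bullet> w = (\<Sum>l\<in>{0..<n}. u $ l * w $ l)"
        using w by (auto simp: scalar_prod_def u_def)
      also have "\<dots> = (\<Sum>l\<in>{k..<a}. (w $ l)\<^sup>2 / sqrt N)"
        using k by (intro sum.mono_neutral_cong_right) (auto simp: u_def power2_eq_square)
      also have "\<dots> = N / sqrt N" by (simp add: sum_divide_distrib[symmetric] N_def[symmetric])
      finally show ?thesis using N by (simp add: real_div_sqrt)
    qed
    ultimately have "sqrt N \<le> w $ k" using le by metis
    then show ?thesis using N real_sqrt_le_iff sqrt_le_D by blast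
  qed simp
  \<comment> \<open>The leading square alone already exhausts \<open>N\<close>, so nothing is left
    for the other entries.\<close>
  moreover have "N = (w $ k)\<^sup>2 + (\<Sum>l\<in>{k..<a} - {k}. (w $ l)\<^sup>2)"
    unfolding N_def using k by (intro sum.remove) auto
  moreover have "(w $ i)\<^sup>2 \<le> (\<Sum>l\<in>{k..<a} - {k}. (w $ l)\<^sup>2)"
    using i by (intro member_le_sum) auto
  ultimately have "(w $ i)\<^sup>2 \<le> 0" by linarith
  then show ?thesis by simp
qed

text \<open>Householder reflections carry the basis vectors at \<open>k\<close> to the maximisers,
  so the maximum appears as entry \<open>(k,k)\<close>. With one argument of the form fixed at a
  basis vector, maximality clears the rest of column \<open>k\<close> and row \<open>k\<close> of
  the block.\<close>

lemma block_svd_step: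
  assumes X: "X \<in> carrier_mat d p" and k: "k < a" "a \<le> d" "k < b" "b \<le> p"
  obtains U V where "orth_on d k a U" "orth_on p k b V"
    "\<And>u v. u \<in> unit_on d k a \<Longrightarrow> v \<in> unit_on p k b \<Longrightarrow>
      u \<bullet> ((U * X * V) *\<^sub>v v) \<le> (U * X * V) $$ (k,k)"
    "\<And>i. k < i \<Longrightarrow> i < a \<Longrightarrow> (U * X * V) $$ (i,k) = 0"
    "\<And>j. k < j \<Longrightarrow> j < b \<Longrightarrow> (U * X * V) $$ (k,j) = 0"
proof -
  obtain u v where u: "u \<in> unit_on d k a" and v: "v \<in> unit_on p k b"
    and max: "\<And>u' v'. u' \<in> unit_on d k a \<Longrightarrow> v' \<in> unit_on p k b \<Longrightarrow> u' \<bullet> (X *\<^sub>v v') \<le> u \<bullet> (X *\<^sub>v v)"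
    using bilinear_form_attains_max[OF X k] by metis
  obtain H where H: "orth_on d k a H" "H *\<^sub>v unit_vec d k = u"
    using householder[OF u k(1,2)] .
  obtain V where V: "orth_on p k b V" "V *\<^sub>v unit_vec p k = v"
    using householder[OF v k(3,4)] .
  \<comment> \<open>The left factor reaches the first argument of the form transposed, so its
    transpose has to be \<open>H\<close> for the basis vector to become \<open>u\<close>.\<close>
  define U where "U = transpose_mat H"
  have U: "orth_on d k a U" "transpose_mat U = H" using H by (auto simp: U_def orth_on_transpose)
  note c = U(1)[THEN orth_on_orth, THEN orth_mat_carrier] V(1)[THEN orth_on_orth, THEN orth_mat_carrier]
  note bil = orth_mat_bilinear[OF orth_on_orth[OF U(1)] orth_on_orth[OF V(1)] X]
  define Y where "Y = U * X * V"
  have Y: "Y \<in> carrier_mat d p" using c X by (simp add: Y_def)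
  have e: "unit_vec d k \<in> unit_on d k a" "unit_vec p k \<in> unit_on p k b"
    using k by (auto intro!: unit_on_unit_vec)
  have "Y $$ (k,k) = u \<bullet> (X *\<^sub>v v)"
    using bil[of "unit_vec d k" "unit_vec p k"] index_mat_bilinear[OF Y, of k k] k
    by (simp add: Y_def U(2) H(2) V(2))
  moreover have "u' \<bullet> (Y *\<^sub>v v') \<le> u \<bullet> (X *\<^sub>v v)"
    if "u' \<in> unit_on d k a" "v' \<in> unit_on p k b" for u' v'
    using bil[of u' v'] that max orth_on_unit_on[OF H(1) that(1)] orth_on_unit_on[OF V(1) that(2)]
    by (simp add: Y_def U(2) unit_on_D(1))
  ultimately have le: "u' \<bullet> (Y *\<^sub>v v') \<le> Y $$ (k,k)"
    if "u' \<in> unit_on d k a" "v' \<in> unit_on p k b" for u' v'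
    using that by simp
  have col: "Y $$ (i,k) = 0" if i: "k < i" "i < a" for i
  proof -
    have Yk: "Y *\<^sub>v unit_vec p k = col Y k" using Y k by auto
    have "col Y k $ i = 0"
    proof (rule dominated_by_leading_entry[OF _ k(1,2) _ i])
      fix u' assume "u' \<in> unit_on d k a"
      from le[OF this e(2)] show "u' \<bullet> col Y k \<le> col Y k $ k"
        using Y k by (simp add: Yk)
    qed (use Y in auto)
    then show ?thesis using Y k i by simp
  qed
  have row: "Y $$ (k,j) = 0" if j: "k < j" "j < b" for j
  proof -
    have "row Y k $ j = 0"
    proof (rule dominated_by_leading_entry[OF _ k(3,4) _ j])
      fix v' assume v': "v' \<in> unit_on p k b"
      have "unit_vec d k \<bullet> (Y *\<^sub>v v') = v' \<bullet> row Y k"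
        using Y k unit_on_D(1)[OF v'] comm_scalar_prod[of "row Y k" p v'] row_carrier_vec[of k d Y p]
        by simp
      then show "v' \<bullet> row Y k \<le> row Y k $ k"
        using le[OF e(1) v'] Y k by simp
    qed (use Y in auto)
    then show ?thesis using Y k j by simp
  qed
  show thesis
    using that[OF U(1) V(1)] le col row unfolding Y_def by blast
qed

text \<open>Once entry \<open>(k,k)\<close> is maximal and its row and column are cleared within the
  block, the block from \<open>Suc k\<close> on is treated recursively. Later diagonal entries are
  values of the same form at unit vectors, which gives the descending order.\<close>

theorem block_svd:
  assumes "X \<in> carrier_mat d p" "a \<le> d" "b \<le> p"
  shows "\<exists>U V. orth_on d k a U \<and> orth_on p k b V \<and> diag_block k a b (U * X * V)"
  using assms
proof (induction "min a b - k" arbitrary: k X)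
  \<comment> \<open>Here the block has no rows or no columns, so every condition is vacuous.\<close>
  case 0
  then have "diag_block k a b (1\<^sub>m d * X * 1\<^sub>m p)" by (auto simp: diag_block_def)
  then show ?case using orth_on_one by blast
next
  case (Suc n)
  then have k: "k < a" "a \<le> d" "k < b" "b \<le> p" and X: "X \<in> carrier_mat d p" by auto
  obtain U1 V1 where U1: "orth_on d k a U1" and V1: "orth_on p k b V1"
    and le: "\<And>u v. u \<in> unit_on d k a \<Longrightarrow> v \<in> unit_on p k b \<Longrightarrow>
      u \<bullet> ((U1 * X * V1) *\<^sub>v v) \<le> (U1 * X * V1) $$ (k,k)"
    and col: "\<And>i. k < i \<Longrightarrow> i < a \<Longrightarrow> (U1 * X * V1) $$ (i,k) = 0"
    and row: "\<And>j. k < j \<Longrightarrow> j < b \<Longrightarrow> (U1 * X * V1) $$ (k,j) = 0"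
    using block_svd_step[OF X k] by blast
  define Y where "Y = U1 * X * V1"
  note c1 = U1[THEN orth_on_orth, THEN orth_mat_carrier] V1[THEN orth_on_orth, THEN orth_mat_carrier]
  have Y: "Y \<in> carrier_mat d p" using X c1 by (simp add: Y_def)
  obtain U2 V2 where U2: "orth_on d (Suc k) a U2" and V2: "orth_on p (Suc k) b V2"
    and diag: "diag_block (Suc k) a b (U2 * Y * V2)"
    using Suc.hyps(1)[OF _ Y k(2,4), of "Suc k"] Suc.hyps(2) by (metis Suc_diff_Suc diff_Suc_1 zero_less_Suc zero_less_diff)
  note c2 = U2[THEN orth_on_orth, THEN orth_mat_carrier] V2[THEN orth_on_orth, THEN orth_mat_carrier]
  define Z where "Z = U2 * Y * V2"
  have Z: "Z \<in> carrier_mat d p" using Y c2 by (simp add: Z_def)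
  have UY: "U2 * Y \<in> carrier_mat d p" and YV: "Y * V2 \<in> carrier_mat d p" using Y c2 by auto
  have Zk: "Z $$ (k,j) = (Y * V2) $$ (k,j)" if "j < p" for j
  proof -
    have "Z = U2 * (Y * V2)" using c2 Y by (simp add: Z_def assoc_mult_mat[of _ d d _ p _ p])
    then show ?thesis using orth_on_mult_left[OF U2 YV, of k j] that k by simp
  qed
  have Zk': "Z $$ (i,k) = (U2 * Y) $$ (i,k)" if "i < d" for i
    unfolding Z_def using orth_on_mult_right[OF V2 UY, of i k] that k by simp
  have Zkk: "Z $$ (k,k) = Y $$ (k,k)"
    using Zk[of k] orth_on_mult_right[OF V2 Y, of k k] k by simp
  \<comment> \<open>Column \<open>j\<close> of \<open>V2\<close> combines only columns with index
    from \<open>Suc k\<close> to \<open>b - 1\<close>, where row \<open>k\<close> of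
    \<open>Y\<close> is already zero. The argument for \<open>Zcol\<close> is the mirror
    image.\<close>
  have Zrow: "Z $$ (k,j) = 0" if j: "k < j" "j < b" for j
  proof -
    have "Z $$ (k,j) = (\<Sum>l<p. Y $$ (k,l) * V2 $$ (l,j))"
      using Zk[of j] index_mult_mat_sum[OF Y c2(2), of k j] j k by simp
    also have "\<dots> = 0"
    proof (intro sum.neutral ballI)
      fix l assume l: "l \<in> {..<p}"
      show "Y $$ (k,l) * V2 $$ (l,j) = 0"
        using row[of l] orth_on_entry[OF V2, of l j] l j k by (fastforce simp: Y_def)
    qed
    finally show ?thesis .
  qed
  have Zcol: "Z $$ (i,k) = 0" if i: "k < i" "i < a" for i
  proof -
    have "Z $$ (i,k) = (\<Sum>l<d. U2 $$ (i,l) * Y $$ (l,k))"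
      using Zk'[of i] index_mult_mat_sum[OF c2(1) Y, of i k] i k by simp
    also have "\<dots> = 0"
    proof (intro sum.neutral ballI)
      fix l assume l: "l \<in> {..<d}"
      show "U2 $$ (i,l) * Y $$ (l,k) = 0"
        using col[of l] orth_on_entry[OF U2, of i l] l i k by (fastforce simp: Y_def)
    qed
    finally show ?thesis .
  qed
  have Yle: "u \<bullet> (Y *\<^sub>v v) \<le> Z $$ (k,k)" if "u \<in> unit_on d k a" "v \<in> unit_on p k b" for u v
    using le[OF that] by (simp add: Y_def[symmetric] Zkk)
  have Zle: "Z $$ (j,j) \<le> Z $$ (k,k)" if j: "k \<le> j" "j < a" "j < b" for j
  proof -
    \<comment> \<open>The entry is the form of \<open>Y\<close> at rotated basis vectors, which are
      unit vectors of the larger block from \<open>k\<close> on.\<close>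
    have "Z $$ (j,j) = (transpose_mat U2 *\<^sub>v unit_vec d j) \<bullet> (Y *\<^sub>v (V2 *\<^sub>v unit_vec p j))"
      using orth_mat_bilinear[OF orth_on_orth[OF U2] orth_on_orth[OF V2] Y, of "unit_vec d j" "unit_vec p j"]
        index_mat_bilinear[OF Z, of j j] j k by (simp add: Z_def)
    also have "\<dots> \<le> Z $$ (k,k)"
      using j k orth_on_mono[OF U2, of k a] orth_on_mono[OF V2, of k b]
      by (intro Yle orth_on_unit_on orth_on_transpose unit_on_unit_vec) auto
    finally show ?thesis .
  qed
  have Zkk0: "0 \<le> Z $$ (k,k)"
  proof -
    \<comment> \<open>Negating one basis vector shows that the maximum is at least its own
      negative.\<close>
    have "- (unit_vec d k \<bullet> (Y *\<^sub>v unit_vec p k)) \<le> Z $$ (k,k)"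
      using Yle[of "- unit_vec d k" "unit_vec p k"] k Y
      by (simp add: unit_on_uminus unit_on_unit_vec)
    then show ?thesis using index_mat_bilinear[OF Y, of k k] k by (simp add: Zkk)
  qed
  have "diag_block k a b Z"
    unfolding diag_block_def
  proof (intro conjI allI impI)
    fix i j assume "k \<le> i" "i < a" "k \<le> j" "j < b" "i \<noteq> j"
    then show "Z $$ (i,j) = 0"
      using diag Zrow Zcol unfolding diag_block_def Z_def[symmetric]
      by (metis Suc_leI le_neq_implies_less)
  next
    fix i assume "k \<le> i" "i < a" "i < b"
    then show "0 \<le> Z $$ (i,i)"
      using diag Zkk0 unfolding diag_block_def Z_def[symmetric]
      by (metis Suc_leI le_neq_implies_less)
  next
    fix i j assume "k \<le> i" "i \<le> j" "j < a" "j < b"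
    then show "Z $$ (j,j) \<le> Z $$ (i,i)"
      using diag Zle unfolding diag_block_def Z_def[symmetric]
      by (metis Suc_leI le_neq_implies_less)
  qed
  moreover have "Z = (U2 * U1) * X * (V1 * V2)"
    unfolding Z_def Y_def using c1 c2 X
    by (simp add: assoc_mult_mat[of _ d d _ d _ p] assoc_mult_mat[of _ d d _ p _ p]
        assoc_mult_mat[of _ d p _ p _ p])
  moreover have "orth_on d k a (U2 * U1)" "orth_on p k b (V1 * V2)"
    using U1 U2 V1 V2 by (auto intro!: orth_on_mult intro: orth_on_mono)
  ultimately show ?case by metis
qed

section \<open>Existence and uniqueness of singular values\<close>

lemma rect_diag_carrier [simp]: "rect_diag d p x \<in> carrier_mat d p"
  by (simp add: rect_diag_def)

lemma rect_diag_index: "i < d \<Longrightarrow> j < p \<Longrightarrow> rect_diag d p x $$ (i,j) = (if i = j then x $ i else 0)"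
  by (simp add: rect_diag_def)

text \<open>The block is the whole matrix; since \<open>d \<le> p\<close>, every row meets the
  diagonal.\<close>

lemma svd_exists:
  assumes X: "X \<in> carrier_mat d p" and dp: "d \<le> p"
  shows "\<exists>s. is_sing_vals d p X s"
proof -
  obtain U V where U: "orth_mat d U" and V: "orth_mat p V" and diag: "diag_block 0 d p (U * X * V)"
    using block_svd[OF X, of d p 0] orth_on_orth by blast
  define s where "s = vec d (\<lambda>i. (U * X * V) $$ (i,i))"
  note c = U[THEN orth_mat_carrier] V[THEN orth_mat_carrier]
  have "U * X * V = rect_diag d p s"
    using diag c X dp by (intro eq_matI) (auto simp: rect_diag_def diag_block_def s_def simp del: index_mult_mat(1))
  then have "X = transpose_mat U * rect_diag d p s * transpose_mat V"
    using orth_mat_cancel[OF U V X] by simp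
  moreover have "s $ j \<le> s $ i" if "i \<le> j" "j < d" for i j
    using diag that dp by (simp add: diag_block_def s_def del: index_mult_mat(1))
  moreover have "0 \<le> s $ i" if "i < d" for i
    using diag that dp by (simp add: diag_block_def s_def del: index_mult_mat(1))
  ultimately have "is_sing_vals d p X s"
    unfolding is_sing_vals_def using U V by (auto simp: s_def intro!: orth_mat_transpose)
  then show ?thesis by blast
qed

text \<open>
  The characteristic polynomial of \<open>X X\<^sup>T\<close> determines the squared singular values as a multiset; this is
  what makes the \<open>THE\<close> in \<open>sing_vals\<close> well defined.
\<close>

lemma char_poly_gram:
  assumes U: "orth_mat d U" and V: "orth_mat p V" and dp: "d \<le> p"
    and X: "X = U * rect_diag d p x * V"
  shows "char_poly (X * transpose_mat X) = (\<Prod>a\<leftarrow>map (\<lambda>i. (x $ i)\<^sup>2) [0..<d]. [:- a, 1:])"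
proof -
  define S where "S = rect_diag d p x"
  define D where "D = S * transpose_mat S"
  have S: "S \<in> carrier_mat d p" by (simp add: S_def)
  have D: "D \<in> carrier_mat d d" using S by (simp add: D_def)
  note c = U[THEN orth_mat_carrier] V[THEN orth_mat_carrier]
  have D_index: "D $$ (i,j) = (if i = j then (x $ i)\<^sup>2 else 0)" if "i < d" "j < d" for i j
  proof -
    have "D $$ (i,j) = (\<Sum>l<p. S $$ (i,l) * transpose_mat S $$ (l,j))"
      unfolding D_def using S that by (intro index_mult_mat_sum[of _ d p _ d]) auto
    also have "\<dots> = (\<Sum>l<p. if l = i then (if i = j then (x $ i)\<^sup>2 else 0) else 0)"
      using that by (intro sum.cong) (auto simp: S_def rect_diag_def power2_eq_square)
    finally show ?thesis using that dp by simp
  qed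
  have "X * transpose_mat X = U * S * V * (transpose_mat V * transpose_mat S * transpose_mat U)"
    using c S by (simp add: X S_def[symmetric] transpose_mult[of _ d p _ p] transpose_mult[of _ d d _ p]
        assoc_mult_mat[of _ p p _ d _ d])
  also have "\<dots> = U * S * (V * transpose_mat V) * (transpose_mat S * transpose_mat U)"
    using c S by (simp add: assoc_mult_mat[of _ d p _ p _ p] assoc_mult_mat[of _ d p _ p _ d]
        assoc_mult_mat[of _ p p _ d _ d] assoc_mult_mat[of _ p p _ p _ d] assoc_mult_mat[of _ d d _ p _ p]
        assoc_mult_mat[of _ d d _ p _ d])
  also have "\<dots> = U * D * transpose_mat U"
    using c S unfolding D_def orth_mat_mult_transpose[OF V]
    by (simp add: assoc_mult_mat[of _ d d _ p _ d] assoc_mult_mat[of _ d d _ d _ d]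
        assoc_mult_mat[of _ d p _ d _ d])
  finally have eq: "X * transpose_mat X = U * D * transpose_mat U" .
  \<comment> \<open>Conjugation by the orthogonal \<open>U\<close> keeps the characteristic
    polynomial, and \<open>D\<close> is diagonal with the squares of the entries of
    \<open>x\<close>.\<close>
  have "similar_mat (X * transpose_mat X) D"
    unfolding similar_mat_def eq
    using c D orth_mat_mult_transpose[OF U] orth_mat_transpose_mult[OF U]
    by (intro exI[of _ U] exI[of _ "transpose_mat U"] similar_mat_witI[of _ _ d]) auto
  then have "char_poly (X * transpose_mat X) = char_poly D" by (rule char_poly_similar)
  also have "\<dots> = (\<Prod>a\<leftarrow>diag_mat D. [:- a, 1:])"
    using D D_index by (intro char_poly_upper_triangular[OF D]) (auto simp: upper_triangular_def)
  also have "diag_mat D = map (\<lambda>i. (x $ i)\<^sup>2) [0..<d]"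
    using D D_index by (auto simp: diag_mat_def)
  finally show ?thesis .
qed

text \<open>Either list is recovered from its product as the multiset \<open>proots\<close> of roots
  with multiplicity.\<close>

lemma mset_eq_of_prod_linear_factors:
  fixes xs ys :: "real list"
  assumes "(\<Prod>a\<leftarrow>xs. [:- a, 1:]) = (\<Prod>a\<leftarrow>ys. [:- a, 1:])"
  shows "mset xs = mset ys"
proof -
  have "proots (\<Prod>a\<leftarrow>xs. [:- a, 1:]) = mset xs" for xs :: "real list"
  proof (induction xs)
    case (Cons a xs)
    have "(\<Prod>a\<leftarrow>xs. [:- a, 1:]) \<noteq> 0" by (auto simp: prod_list_zero_iff)
    then have "proots ([:- a, 1:] * (\<Prod>a\<leftarrow>xs. [:- a, 1:])) = proots [:- a, 1:] + mset xs"
      by (subst proots_mult) (simp_all only: Cons.IH, simp_all)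
    then show ?case by (simp del: mult_pCons_left)
  qed simp
  then show ?thesis using assms by metis
qed

text \<open>Neither order nor sign of the diagonals is prescribed, so this also serves diagonal
  matrices with unsorted or negative entries. The characteristic polynomial gives the squares, and
  square roots turn them into absolute values.\<close>

lemma svd_unique_up_to_signed_permutation:
  assumes "orth_mat d U" "orth_mat p V" "orth_mat d U'" "orth_mat p V'" "d \<le> p"
    and "U * rect_diag d p x * V = U' * rect_diag d p y * V'"
  shows "mset (map (\<lambda>i. \<bar>x $ i\<bar>) [0..<d]) = mset (map (\<lambda>i. \<bar>y $ i\<bar>) [0..<d])"
proof -
  have "mset (map (\<lambda>i. (x $ i)\<^sup>2) [0..<d]) = mset (map (\<lambda>i. (y $ i)\<^sup>2) [0..<d])"
    using char_poly_gram[OF assms(1,2,5) refl] char_poly_gram[OF assms(3,4,5) assms(6)]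
    by (intro mset_eq_of_prod_linear_factors) metis
  then have "image_mset sqrt (mset (map (\<lambda>i. (x $ i)\<^sup>2) [0..<d]))
      = image_mset sqrt (mset (map (\<lambda>i. (y $ i)\<^sup>2) [0..<d]))" by (rule arg_cong)
  then show ?thesis by (simp add: mset_map[symmetric] comp_def del: mset_map)
qed

text \<open>A descending list is determined by its multiset; the lists are reversed because
  \<open>sorted\<close> is ascending.\<close>

lemma sing_vals_unique:
  assumes "is_sing_vals d p X s" "is_sing_vals d p X t" and dp: "d \<le> p"
  shows "s = t"
proof -
  have abs: "map (\<lambda>i. \<bar>s $ i\<bar>) [0..<d] = map (\<lambda>i. s $ i) [0..<d]"
    "sorted (rev (map (\<lambda>i. s $ i) [0..<d]))" if "is_sing_vals d p X s" for s
    using that by (auto simp: is_sing_vals_def sorted_rev_iff_nth_mono)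
  have "mset (rev (map (\<lambda>i. s $ i) [0..<d])) = mset (rev (map (\<lambda>i. t $ i) [0..<d]))"
  proof -
    obtain U V U' V' where "orth_mat d U" "orth_mat p V" "X = U * rect_diag d p s * V"
      "orth_mat d U'" "orth_mat p V'" "X = U' * rect_diag d p t * V'"
      using assms unfolding is_sing_vals_def by blast
    then have "mset (map (\<lambda>i. \<bar>s $ i\<bar>) [0..<d]) = mset (map (\<lambda>i. \<bar>t $ i\<bar>) [0..<d])"
      using svd_unique_up_to_signed_permutation dp by metis
    then show ?thesis unfolding abs(1)[OF assms(1)] abs(1)[OF assms(2)] by simp
  qed
  then have "rev (map (\<lambda>i. s $ i) [0..<d]) = rev (map (\<lambda>i. t $ i) [0..<d])"
    using abs(2)[OF assms(1)] abs(2)[OF assms(2)] by (metis properties_for_sort)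
  then have "s $ i = t $ i" if "i < d" for i
    using that by (metis (no_types, lifting) add_0 diff_zero length_upt nth_map nth_upt rev_is_rev_conv rev_rev_ident)
  then show ?thesis using assms by (intro eq_vecI) (auto simp: is_sing_vals_def)
qed

lemma is_sing_vals_sing_vals:
  assumes "X \<in> carrier_mat d p" "d \<le> p"
  shows "is_sing_vals d p X (sing_vals d p X)"
  unfolding sing_vals_def using svd_exists[OF assms] sing_vals_unique assms(2) by (metis theI')

text \<open>Such vectors differ by a permutation and a choice of signs, the two symmetries of a
  gauge.\<close>

lemma symmetric_gauge_abs_mset:
  assumes f: "symmetric_gauge d f" and x: "x \<in> carrier_vec d" and y: "y \<in> carrier_vec d"
    and eq: "mset (map (\<lambda>i. \<bar>x $ i\<bar>) [0..<d]) = mset (map (\<lambda>i. \<bar>y $ i\<bar>) [0..<d])"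
  shows "f x = f y"
proof -
  obtain \<pi> where \<pi>: "\<pi> permutes {..<d}"
    and perm: "permute_list \<pi> (map (\<lambda>i. \<bar>y $ i\<bar>) [0..<d]) = map (\<lambda>i. \<bar>x $ i\<bar>) [0..<d]"
    using mset_eq_permutation[OF eq] by auto
  have xy: "\<bar>x $ i\<bar> = \<bar>y $ \<pi> i\<bar>" if "i < d" for i
  proof -
    have "permute_list \<pi> (map (\<lambda>i. \<bar>y $ i\<bar>) [0..<d]) ! i = \<bar>y $ \<pi> i\<bar>"
      using that \<pi> permutes_in_image[OF \<pi>, of i] by (subst permute_list_nth) auto
    then show ?thesis using that perm by simp
  qed
  define z where "z = vec d (\<lambda>i. y $ \<pi> i)"
  define e where "e i = (if x $ i = z $ i then 1 else - 1 :: real)" for i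
  have "f z = f y" using f \<pi> y by (simp add: symmetric_gauge_def z_def)
  moreover have "f (vec d (\<lambda>i. e i * z $ i)) = f z"
    using f by (simp add: symmetric_gauge_def z_def e_def)
  moreover have "e i * z $ i = x $ i" if "i < d" for i
    using xy[OF that] that by (auto simp: e_def z_def)
  then have "vec d (\<lambda>i. e i * z $ i) = x"
    using x by (intro eq_vecI) auto
  ultimately show ?thesis by simp
qed



subsection \<open>Rank\<close>

text \<open>Every column of the product is \<open>A\<close> applied to a vector, so the column space
  can only shrink.\<close>

lemma rank_mult_le:
  fixes A B :: "real mat"
  assumes A: "A \<in> carrier_mat n m" and B: "B \<in> carrier_mat m q"
  shows "vec_space.rank n (A * B) \<le> vec_space.rank n A"
proof -
  interpret vec_space "TYPE(real)" n .
  have AB: "A * B \<in> carrier_mat n q" using A B by simp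
  have sA: "set (cols A) \<subseteq> carrier_vec n" and sAB: "set (cols (A * B)) \<subseteq> carrier_vec n"
    using A AB cols_dim by blast+
  have "set (cols (A * B)) \<subseteq> span (set (cols A))"
  proof
    fix x assume "x \<in> set (cols (A * B))"
    then obtain j where j: "j < q" "x = col (A * B) j"
      using AB by (auto simp: cols_def)
    have "x = A *\<^sub>v col B j" using A B j by (auto simp: col_mult2)
    then have "x \<in> col_space A" unfolding col_space_eq[OF A] using A B j by auto
    then show "x \<in> span (set (cols A))" by (simp add: col_space_def)
  qed
  then have "span (set (cols (A * B))) \<subseteq> span (set (cols A))"
    using span_is_subset[OF _ span_is_submodule[OF sA]] by simp
  then have sub: "subspace class_ring (span (set (cols (A * B)))) (vs (span (set (cols A))))"
    using nested_subspaces[OF span_is_subspace[OF sA] span_is_subspace[OF sAB]] by simp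
  show ?thesis
    unfolding rank_def
    using vectorspace.subspace_dim[OF subspace_is_vs[OF span_is_subspace[OF sA]] sub
        fin_dim_span_cols[OF A]] fin_dim_span_cols[OF AB] by auto
qed

lemma rank_full_of_injective:
  fixes A :: "real mat"
  assumes A: "A \<in> carrier_mat n m"
    and inj: "\<And>v. v \<in> carrier_vec m \<Longrightarrow> A *\<^sub>v v = 0\<^sub>v n \<Longrightarrow> v = 0\<^sub>v m"
  shows "vec_space.rank n A = m"
proof -
  interpret vec_space "TYPE(real)" n .
  \<comment> \<open>Linear independence is stated for the set of columns, so repetitions must be
    excluded: two equal columns would put a difference of unit vectors into the kernel.\<close>
  have "distinct (cols A)"
    unfolding distinct_conv_nth
  proof (intro allI impI notI)
    fix i j assume ij: "i < length (cols A)" "j < length (cols A)" "i \<noteq> j" "cols A ! i = cols A ! j"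
    then have m: "i < m" "j < m" and col: "col A i = col A j" using A by auto
    have "A *\<^sub>v (unit_vec m i - unit_vec m j) = col A i - col A j"
      using A m by (subst mult_minus_distrib_mat_vec[of _ n m]) auto
    then have "A *\<^sub>v (unit_vec m i - unit_vec m j) = 0\<^sub>v n" using A m col by auto
    then have "unit_vec m i - unit_vec m j = (0\<^sub>v m :: real vec)" by (intro inj) auto
    then have "(unit_vec m i - unit_vec m j :: real vec) $ i = 0" using m by simp
    then show False using m ij(3) by simp
  qed
  then show ?thesis
    using lin_indpt_full_rank[OF A] lin_depE[OF A] inj by metis
qed

text \<open>By the ordering, a nonzero entry at \<open>i\<close> makes the entries \<open>0\<close>
  to \<open>i\<close> all positive. Then \<open>X\<close> times a suitable matrix has rank
  \<open>i + 1\<close>, more than the rank of \<open>X\<close>.\<close>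

lemma sing_vals_zero_beyond_rank:
  assumes sv: "is_sing_vals d p X s" and dp: "d \<le> p" and i: "vec_space.rank d X \<le> i" "i < d"
  shows "s $ i = 0"
proof (rule ccontr)
  assume nz: "s $ i \<noteq> 0"
  define m where "m = Suc i"
  have m: "m \<le> d" "m \<le> p" using i dp by (auto simp: m_def)
  obtain U V where U: "orth_mat d U" and V: "orth_mat p V" and X: "X = U * rect_diag d p s * V"
    using sv by (auto simp: is_sing_vals_def)
  have pos: "0 < s $ l" if "l < m" for l
  proof -
    have "0 \<le> s $ i" "s $ i \<le> s $ l" using sv that i by (auto simp: is_sing_vals_def m_def)
    then show ?thesis using nz by linarith
  qed
  \<comment> \<open>\<open>E\<close> selects the first \<open>m\<close> columns, on which the
    diagonal matrix is injective.\<close>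
  define E where "E = mat p m (\<lambda>(i,j). if i = j then 1 else 0 :: real)"
  define G where "G = rect_diag d p s * E"
  note c = U[THEN orth_mat_carrier] V[THEN orth_mat_carrier]
  have E: "E \<in> carrier_mat p m" and G: "G \<in> carrier_mat d m" by (auto simp: E_def G_def rect_diag_def)
  have Xc: "X \<in> carrier_mat d p" unfolding X using c by (intro mult_carrier_mat[of _ d p] mult_carrier_mat[of _ d d]) auto
  have G_index: "G $$ (a,b) = (if a = b then s $ a else 0)" if "a < d" "b < m" for a b
  proof -
    have "G $$ (a,b) = (\<Sum>l<p. rect_diag d p s $$ (a,l) * E $$ (l,b))"
      unfolding G_def using that by (intro index_mult_mat_sum) (auto simp: E_def rect_diag_def)
    also have "\<dots> = (\<Sum>l<p. if l = a then (if a = b then s $ a else 0) else 0)"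
      using that by (intro sum.cong) (auto simp: E_def rect_diag_def)
    finally show ?thesis using that dp by simp
  qed
  have "X * (transpose_mat V * E) = U * G"
    unfolding X G_def using c E orth_mat_mult_transpose[OF V]
    by (simp add: assoc_mult_mat[of _ d d _ p _ m] assoc_mult_mat[of _ d p _ p _ m]
        assoc_mult_mat[symmetric, of V p p "transpose_mat V" p E m] del: assoc_mult_mat)
  then have "vec_space.rank d (U * G) \<le> vec_space.rank d X"
    using rank_mult_le[OF Xc, of "transpose_mat V * E" m] c E by simp
  moreover have "vec_space.rank d (U * G) = m"
  proof (rule rank_full_of_injective)
    fix v assume v: "v \<in> carrier_vec m" and 0: "(U * G) *\<^sub>v v = 0\<^sub>v d"
    have "G *\<^sub>v v = (transpose_mat U * U) *\<^sub>v (G *\<^sub>v v)"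
      using orth_mat_transpose_mult[OF U] G v by simp
    also have "\<dots> = transpose_mat U *\<^sub>v ((U * G) *\<^sub>v v)" using c G v by simp
    also have "\<dots> = 0\<^sub>v d" unfolding 0 using c by auto
    finally have Gv: "G *\<^sub>v v = 0\<^sub>v d" .
    show "v = 0\<^sub>v m"
    proof (rule eq_vecI)
      fix l assume "l < dim_vec (0\<^sub>v m :: real vec)"
      then have l: "l < m" by simp
      have "(G *\<^sub>v v) $ l = (\<Sum>b<m. G $$ (l,b) * v $ b)"
        using G v l m by (auto simp: scalar_prod_def atLeast0LessThan)
      also have "\<dots> = (\<Sum>b<m. if b = l then s $ l * v $ l else 0)"
        using G_index l m by (intro sum.cong) auto
      finally have "s $ l * v $ l = 0" using Gv l m by simp
      then show "v $ l = 0\<^sub>v m $ l" using pos[OF l] l by simp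
    qed (use v in simp)
  qed (use c G in simp)
  ultimately show False using i by (simp add: m_def)
qed

subsection \<open>Pinching and the Frobenius norm\<close>

definition sign_mat :: "nat \<Rightarrow> (nat \<Rightarrow> real) \<Rightarrow> real mat" where
  "sign_mat n e = mat n n (\<lambda>(i,j). if i = j then e i else 0)"

lemma sign_mat_carrier [simp]: "sign_mat n e \<in> carrier_mat n n"
  by (simp add: sign_mat_def)

lemma sign_mat_mult_left:
  assumes "X \<in> carrier_mat d p" "i < d" "j < p"
  shows "(sign_mat d e * X) $$ (i,j) = e i * X $$ (i,j)"
proof -
  have "(sign_mat d e * X) $$ (i,j) = (\<Sum>l<d. sign_mat d e $$ (i,l) * X $$ (l,j))"
    using assms by (intro index_mult_mat_sum) auto
  also have "\<dots> = (\<Sum>l<d. if l = i then e i * X $$ (i,j) else 0)"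
    using assms by (intro sum.cong) (auto simp: sign_mat_def)
  finally show ?thesis using assms by simp
qed

lemma sign_mat_mult_right:
  assumes "X \<in> carrier_mat d p" "i < d" "j < p"
  shows "(X * sign_mat p e) $$ (i,j) = X $$ (i,j) * e j"
proof -
  have "(X * sign_mat p e) $$ (i,j) = (\<Sum>l<p. X $$ (i,l) * sign_mat p e $$ (l,j))"
    using assms by (intro index_mult_mat_sum) auto
  also have "\<dots> = (\<Sum>l<p. if l = j then X $$ (i,j) * e j else 0)"
    using assms by (intro sum.cong) (auto simp: sign_mat_def)
  finally show ?thesis using assms by simp
qed

lemma orth_sign_mat:
  assumes "\<And>i. i < n \<Longrightarrow> e i * e i = 1"
  shows "orth_mat n (sign_mat n e)"
proof -
  have "transpose_mat (sign_mat n e) = sign_mat n e" by (auto simp: sign_mat_def)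
  moreover have "sign_mat n e * sign_mat n e = 1\<^sub>m n"
  proof (rule eq_matI)
    fix i j assume "i < dim_row (1\<^sub>m n :: real mat)" "j < dim_col (1\<^sub>m n :: real mat)"
    then have ij: "i < n" "j < n" by auto
    show "(sign_mat n e * sign_mat n e) $$ (i,j) = 1\<^sub>m n $$ (i,j)"
      unfolding sign_mat_mult_left[OF sign_mat_carrier ij] using ij assms[of i]
      by (auto simp: sign_mat_def)
  qed (auto simp: sign_mat_def)
  ultimately show ?thesis by (simp add: orth_mat_def)
qed

lemma mat_norm_onD:
  assumes "mat_norm_on d p R" "X \<in> carrier_mat d p" "Y \<in> carrier_mat d p"
  shows "0 \<le> R X" "R (c \<cdot>\<^sub>m X) = \<bar>c\<bar> * R X" "R (X + Y) \<le> R X + R Y"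
  using assms by (auto simp: mat_norm_on_def)


text \<open>
  Pinching: averaging a matrix with its copy in which row and column \<open>m\<close> are negated kills the
  off-diagonal entries of that row and column without increasing the norm.
\<close>

lemma norm_diagonal_le:
  assumes R: "mat_norm_on d p R" and inv: "unitarily_invariant d p R" and X: "X \<in> carrier_mat d p"
    and dp: "d \<le> p"
  shows "R (rect_diag d p (vec d (\<lambda>i. X $$ (i,i)))) \<le> R X"
proof -
  \<comment> \<open>\<open>Z m\<close> has lost the off-diagonal entries of every row and column
    with index below \<open>m\<close>; it runs from \<open>X\<close> to the diagonal part.\<close>
  define Z where "Z m = mat d p (\<lambda>(i,j). if i = j \<or> (m \<le> i \<and> m \<le> j) then X $$ (i,j) else 0)" for m
  have Z: "Z m \<in> carrier_mat d p" for m by (simp add: Z_def)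
  have step: "R (Z (Suc m)) \<le> R (Z m)" for m
  proof -
    define e where "e i = (if i = m then - 1 else 1 :: real)" for i
    define W where "W = sign_mat d e * Z m * sign_mat p e"
    have SZ: "sign_mat d e * Z m \<in> carrier_mat d p" using Z by (rule mult_carrier_mat[OF sign_mat_carrier])
    have W: "W \<in> carrier_mat d p" unfolding W_def using SZ by (rule mult_carrier_mat) simp
    \<comment> \<open>Averaging multiplies each entry by \<open>(1 + e i * e j) / 2\<close>, which
      is \<open>0\<close> if exactly one of \<open>i\<close> and \<open>j\<close> equals
      \<open>m\<close>, and \<open>1\<close> otherwise.\<close>
    have "Z (Suc m) = (1/2) \<cdot>\<^sub>m (Z m + W)"
    proof (rule eq_matI)
      fix i j assume "i < dim_row ((1/2) \<cdot>\<^sub>m (Z m + W))" "j < dim_col ((1/2) \<cdot>\<^sub>m (Z m + W))"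
      then have ij: "i < d" "j < p" using W by auto
      have "W $$ (i,j) = e i * Z m $$ (i,j) * e j"
        unfolding W_def sign_mat_mult_right[OF SZ ij] sign_mat_mult_left[OF Z ij] ..
      then have "((1/2) \<cdot>\<^sub>m (Z m + W)) $$ (i,j) = (1 + e i * e j) / 2 * Z m $$ (i,j)"
        using ij W Z[of m] by (simp add: field_simps)
      also have "\<dots> = Z (Suc m) $$ (i,j)"
        using ij by (auto simp: Z_def e_def)
      finally show "Z (Suc m) $$ (i,j) = ((1/2) \<cdot>\<^sub>m (Z m + W)) $$ (i,j)" by simp
    qed (use W Z in auto)
    moreover have "R W = R (Z m)"
      using inv Z[of m] orth_sign_mat[of d e] orth_sign_mat[of p e]
      unfolding W_def unitarily_invariant_def by (simp add: e_def)
    ultimately show ?thesis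
      using mat_norm_onD(2)[OF R add_carrier_mat[OF W, of "Z m"] W, where c = "1/2"] mat_norm_onD(3)[OF R Z W, of m]
      by simp
  qed
  have "R (Z m) \<le> R (Z 0)" for m
    by (induction m) (auto intro: order_trans[OF step])
  moreover have "Z 0 = X" using X by (auto simp: Z_def)
  moreover have "Z p = rect_diag d p (vec d (\<lambda>i. X $$ (i,i)))"
    using dp by (auto simp: Z_def rect_diag_def)
  ultimately show ?thesis by metis
qed

section \<open>The Frobenius norm and orthogonal factors\<close>

lemma frob_norm_nonneg: "0 \<le> frob_norm X"
  by (simp add: frob_norm_def sum_nonneg)

lemma frob_norm_sum:
  "X \<in> carrier_mat d p \<Longrightarrow> frob_norm X = sqrt (\<Sum>i<d. \<Sum>j<p. (X $$ (i,j))\<^sup>2)"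
  by (auto simp: frob_norm_def)

lemma frob_norm_cols:
  assumes "X \<in> carrier_mat d p"
  shows "frob_norm X = sqrt (\<Sum>j<p. col X j \<bullet> col X j)"
proof -
  have "(\<Sum>i<d. \<Sum>j<p. (X $$ (i,j))\<^sup>2) = (\<Sum>j<p. \<Sum>i<d. (X $$ (i,j))\<^sup>2)"
    by (rule sum.swap)
  also have "\<dots> = (\<Sum>j<p. col X j \<bullet> col X j)"
    using assms by (intro sum.cong) (auto simp: scalar_prod_def power2_eq_square atLeast0LessThan)
  finally show ?thesis using frob_norm_sum[OF assms] by simp
qed

lemma frob_norm_transpose: "X \<in> carrier_mat d p \<Longrightarrow> frob_norm (transpose_mat X) = frob_norm X"
  by (simp add: frob_norm_sum[of _ d p] frob_norm_sum[of _ p d] sum.swap[of _ "{..<p}"])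

lemma frob_norm_orth_left:
  assumes U: "orth_mat d U" and X: "X \<in> carrier_mat d p"
  shows "frob_norm (U * X) = frob_norm X"
proof -
  note c = U[THEN orth_mat_carrier]
  have "col (U * X) j \<bullet> col (U * X) j = col X j \<bullet> col X j" if "j < p" for j
  proof -
    have "col (U * X) j = U *\<^sub>v col X j" using c X that by (rule col_mult2)
    moreover have "col X j \<in> carrier_vec d" using X that by auto
    ultimately show ?thesis using orth_mat_scalar_prod[OF U] by simp
  qed
  then show ?thesis
    using frob_norm_cols[OF X] frob_norm_cols[OF mult_carrier_mat[OF c X]] by simp
qed

text \<open>The left factor preserves the length of each column; the right factor is reduced to this
  case by transposition.\<close>

lemma frob_norm_orth:
  assumes U: "orth_mat d U" and V: "orth_mat p V" and X: "X \<in> carrier_mat d p"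
  shows "frob_norm (U * X * V) = frob_norm X"
proof -
  note c = U[THEN orth_mat_carrier] V[THEN orth_mat_carrier]
  have UX: "U * X \<in> carrier_mat d p" using c X by simp
  have "frob_norm (U * X * V) = frob_norm (transpose_mat V * transpose_mat (U * X))"
    using frob_norm_transpose[of "U * X * V" d p] transpose_mult[OF UX c(2)] mult_carrier_mat[OF UX c(2)]
    by simp
  also have "\<dots> = frob_norm (transpose_mat (U * X))"
    using UX by (intro frob_norm_orth_left[of p _ _ d] orth_mat_transpose V) simp
  also have "\<dots> = frob_norm X"
    using frob_norm_transpose[OF UX] frob_norm_orth_left[OF U X] by simp
  finally show ?thesis .
qed

lemma frob_norm_mono:
  assumes "X \<in> carrier_mat d p" "Y \<in> carrier_mat d p"
    and "\<And>i j. i < d \<Longrightarrow> j < p \<Longrightarrow> \<bar>X $$ (i,j)\<bar> \<le> \<bar>Y $$ (i,j)\<bar>"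
  shows "frob_norm X \<le> frob_norm Y"
  unfolding frob_norm_sum[OF assms(1)] frob_norm_sum[OF assms(2)]
  by (intro real_sqrt_le_mono sum_mono) (use assms(3) in \<open>auto simp: abs_le_square_iff\<close>)

lemma frob_norm_rect_diag:
  assumes "d \<le> p" "x \<in> carrier_vec d"
  shows "frob_norm (rect_diag d p x) = l2_norm x"
proof -
  have "(\<Sum>j<p. (rect_diag d p x $$ (i,j))\<^sup>2) = (x $ i)\<^sup>2" if "i < d" for i
  proof -
    have "(\<Sum>j<p. (rect_diag d p x $$ (i,j))\<^sup>2) = (\<Sum>j<p. if j = i then (x $ i)\<^sup>2 else 0)"
      using that by (intro sum.cong) (auto simp: rect_diag_def)
    then show ?thesis using that assms by simp
  qed
  then show ?thesis using assms by (simp add: frob_norm_sum[of _ d p] l2_norm_def)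
qed

lemma frob_norm_eq_0_iff:
  assumes "X \<in> carrier_mat d p"
  shows "frob_norm X = 0 \<longleftrightarrow> X = 0\<^sub>m d p"
proof
  assume "frob_norm X = 0"
  then have "\<forall>i\<in>{..<d}. \<forall>j\<in>{..<p}. X $$ (i,j) = 0"
    using frob_norm_sum[OF assms] by (simp add: sum_nonneg_eq_0_iff sum_nonneg)
  then show "X = 0\<^sub>m d p" using assms by (intro eq_matI) auto
qed (simp add: frob_norm_def)

lemma frob_norm_smult:
  assumes "X \<in> carrier_mat d p"
  shows "frob_norm (t \<cdot>\<^sub>m X) = \<bar>t\<bar> * frob_norm X"
proof -
  have "(\<Sum>i<d. \<Sum>j<p. ((t \<cdot>\<^sub>m X) $$ (i,j))\<^sup>2) = t\<^sup>2 * (\<Sum>i<d. \<Sum>j<p. (X $$ (i,j))\<^sup>2)"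
    using assms by (auto simp: power_mult_distrib sum_distrib_left)
  then show ?thesis
    using frob_norm_sum[OF assms] frob_norm_sum[OF smult_carrier_mat[OF assms], of t]
    by (simp add: real_sqrt_mult)
qed

text \<open>The rotation only mixes rows with index at least \<open>k\<close>, all of which vanish
  in \<open>S\<close>. This lets the error be rotated without disturbing the diagonalised
  target.\<close>

lemma orth_on_mult_left_id:
  assumes U: "orth_on n k a U" and S: "S \<in> carrier_mat n q"
    and 0: "\<And>i j. i < n \<Longrightarrow> j < q \<Longrightarrow> k \<le> i \<Longrightarrow> S $$ (i,j) = 0"
  shows "U * S = S"
proof (rule eq_matI)
  note c = U[THEN orth_on_orth, THEN orth_mat_carrier]
  fix i j assume "i < dim_row S" "j < dim_col S"
  then have ij: "i < n" "j < q" using S by auto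
  have "(U * S) $$ (i,j) = (\<Sum>l<n. U $$ (i,l) * S $$ (l,j))"
    using c S ij by (intro index_mult_mat_sum)
  also have "\<dots> = (\<Sum>l<n. if l = i then S $$ (i,j) else 0)"
  proof (rule sum.cong)
    fix l assume "l \<in> {..<n}"
    then show "U $$ (i,l) * S $$ (l,j) = (if l = i then S $$ (i,j) else 0)"
      using 0[of l j] ij orth_on_entry[OF U ij(1), of l] by (cases "k \<le> l") auto
  qed simp
  finally show "(U * S) $$ (i,j) = S $$ (i,j)" using ij by simp
qed (use S orth_mat_carrier[OF orth_on_orth[OF U]] in auto)

lemma orth_on_mult_right_id:
  assumes V: "orth_on n k b V" and S: "S \<in> carrier_mat q n"
    and 0: "\<And>i j. i < q \<Longrightarrow> j < n \<Longrightarrow> k \<le> j \<Longrightarrow> S $$ (i,j) = 0"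
  shows "S * V = S"
proof -
  have "transpose_mat V * transpose_mat S = transpose_mat S"
    using S 0 by (intro orth_on_mult_left_id[OF orth_on_transpose[OF V], of _ q]) auto
  then show ?thesis
    using transpose_mult[OF S orth_mat_carrier[OF orth_on_orth[OF V]]] by (metis transpose_transpose)
qed

subsection \<open>The error bound\<close>

locale unitarily_invariant_norm =
  fixes d p :: nat and R :: "real mat \<Rightarrow> real" and f :: "real vec \<Rightarrow> real"
  assumes dp: "d \<le> p"
    and norm: "mat_norm_on d p R"
    and inv: "unitarily_invariant d p R"
    and gauge: "symmetric_gauge d f"
    and R_eq: "\<forall>X\<in>carrier_mat d p. R X = f (sing_vals d p X)"
begin

section \<open>The norm of diagonal matrices and of matrices with few rows or columns\<close>

lemma R_orth:
  assumes "orth_mat d U" "orth_mat p V" "X \<in> carrier_mat d p"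
  shows "R (U * X * V) = R X"
  using assms inv by (simp add: unitarily_invariant_def)

text \<open>The entries of \<open>x\<close> may be unsorted and of either sign; they agree with the
  singular values up to a signed permutation, to which \<open>f\<close> is blind.\<close>

lemma R_rect_diag:
  assumes x: "x \<in> carrier_vec d"
  shows "R (rect_diag d p x) = f x"
proof -
  define s where "s = sing_vals d p (rect_diag d p x)"
  have "is_sing_vals d p (rect_diag d p x) s"
    unfolding s_def using dp by (intro is_sing_vals_sing_vals) simp
  then obtain U V where s: "s \<in> carrier_vec d" and UV: "orth_mat d U" "orth_mat p V"
    and eq: "rect_diag d p x = U * rect_diag d p s * V"
    by (auto simp: is_sing_vals_def)
  have one: "orth_mat d (1\<^sub>m d)" "orth_mat p (1\<^sub>m p)" by (auto simp: orth_mat_def)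
  have "1\<^sub>m d * rect_diag d p x * 1\<^sub>m p = U * rect_diag d p s * V"
    unfolding eq[symmetric] by (metis left_mult_one_mat rect_diag_carrier right_mult_one_mat)
  then have "f x = f s"
    using svd_unique_up_to_signed_permutation[OF one UV dp] symmetric_gauge_abs_mset[OF gauge x s] by blast
  then show ?thesis using R_eq by (simp add: s_def)
qed

text \<open>The matrix is orthogonally equivalent to a diagonal one with at most \<open>r\<close>
  nonzero entries, and orthogonal factors change neither norm, so the vector inequality for
  \<open>f\<close> carries over.\<close>

lemma R_le_of_diag:
  assumes bound: "\<And>\<delta>. \<delta> \<in> carrier_vec d \<Longrightarrow> l0_norm \<delta> \<le> r \<Longrightarrow> f \<delta> \<le> \<phi> * l2_norm \<delta>"
    and UV: "orth_mat d U" "orth_mat p V" and X: "X \<in> carrier_mat d p"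
    and diag: "\<And>i j. i < d \<Longrightarrow> j < p \<Longrightarrow> i \<noteq> j \<or> r \<le> i \<Longrightarrow> (U * X * V) $$ (i,j) = 0"
  shows "R X \<le> \<phi> * frob_norm X"
proof -
  define \<delta> where "\<delta> = vec d (\<lambda>i. (U * X * V) $$ (i,i))"
  have \<delta>: "\<delta> \<in> carrier_vec d" by (simp add: \<delta>_def)
  have "U * X * V \<in> carrier_mat d p" using UV X
    by (intro mult_carrier_mat[of _ d p] mult_carrier_mat[of _ d d] orth_mat_carrier)
  then have eq: "U * X * V = rect_diag d p \<delta>"
    using diag dp by (intro eq_matI) (auto simp: rect_diag_def \<delta>_def simp del: index_mult_mat(1))
  have "\<delta> $ i = 0" if "i < d" "r \<le> i" for i
    using diag[of i i] that dp by (simp add: \<delta>_def del: index_mult_mat(1))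
  then have "{i. i < dim_vec \<delta> \<and> \<delta> $ i \<noteq> 0} \<subseteq> {..<r}"
    using \<delta> by (auto simp: not_less[symmetric])
  then have "l0_norm \<delta> \<le> r"
    unfolding l0_norm_def by (metis card_lessThan card_mono finite_lessThan)
  then have "f \<delta> \<le> \<phi> * l2_norm \<delta>" using bound \<delta> by blast
  then show ?thesis
    using R_orth[OF UV X] frob_norm_orth[OF UV X] R_rect_diag[OF \<delta>] frob_norm_rect_diag[OF dp \<delta>]
    by (simp add: eq)
qed

text \<open>The left rotation is confined to the leading rows, so that the zero rows stay zero while
  the others are diagonalised.\<close>

lemma R_le_few_rows:
  assumes bound: "\<And>\<delta>. \<delta> \<in> carrier_vec d \<Longrightarrow> l0_norm \<delta> \<le> r \<Longrightarrow> f \<delta> \<le> \<phi> * l2_norm \<delta>"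
    and X: "X \<in> carrier_mat d p"
    and 0: "\<And>i j. i < d \<Longrightarrow> j < p \<Longrightarrow> r \<le> i \<Longrightarrow> X $$ (i,j) = 0"
  shows "R X \<le> \<phi> * frob_norm X"
proof -
  obtain U V where U: "orth_on d 0 (min r d) U" and V: "orth_on p 0 p V"
    and diag: "diag_block 0 (min r d) p (U * X * V)"
    using block_svd[OF X, of "min r d" p 0] by auto
  note c = U[THEN orth_on_orth, THEN orth_mat_carrier] V[THEN orth_on_orth, THEN orth_mat_carrier]
  have UX: "U * X \<in> carrier_mat d p" using c(1) X by (rule mult_carrier_mat)
  show ?thesis
  proof (rule R_le_of_diag[OF bound orth_on_orth[OF U] orth_on_orth[OF V] X])
    fix i j assume ij: "i < d" "j < p" "i \<noteq> j \<or> r \<le> i"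
    show "(U * X * V) $$ (i,j) = 0"
    proof (cases "i < r")
      case False
      have "(U * X * V) $$ (i,j) = (\<Sum>l<p. (U * X) $$ (i,l) * V $$ (l,j))"
        using UX c(2) ij(1,2) by (rule index_mult_mat_sum)
      also have "\<dots> = 0"
        using orth_on_mult_left[OF U X ij(1)] 0 ij False by (intro sum.neutral) auto
      finally show ?thesis .
    qed (use diag ij in \<open>simp add: diag_block_def del: index_mult_mat(1)\<close>)
  qed
qed

text \<open>Mirror image of the row case, with the right rotation confined to the leading columns.
  It is argued directly rather than by transposing, since \<open>R\<close> is a norm on
  \<open>d\<close> by \<open>p\<close> matrices.\<close>

lemma R_le_few_cols:
  assumes bound: "\<And>\<delta>. \<delta> \<in> carrier_vec d \<Longrightarrow> l0_norm \<delta> \<le> r \<Longrightarrow> f \<delta> \<le> \<phi> * l2_norm \<delta>"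
    and X: "X \<in> carrier_mat d p"
    and 0: "\<And>i j. i < d \<Longrightarrow> j < p \<Longrightarrow> r \<le> j \<Longrightarrow> X $$ (i,j) = 0"
  shows "R X \<le> \<phi> * frob_norm X"
proof -
  obtain U V where U: "orth_on d 0 d U" and V: "orth_on p 0 (min r p) V"
    and diag: "diag_block 0 d (min r p) (U * X * V)"
    using block_svd[OF X, of d "min r p" 0] by auto
  note c = U[THEN orth_on_orth, THEN orth_mat_carrier] V[THEN orth_on_orth, THEN orth_mat_carrier]
  have XV: "X * V \<in> carrier_mat d p" using X c(2) by (rule mult_carrier_mat)
  have zero: "(U * X * V) $$ (i,j) = 0" if ij: "i < d" "j < p" "r \<le> j" for i j
  proof -
    have "(U * X * V) $$ (i,j) = (U * (X * V)) $$ (i,j)"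
      using assoc_mult_mat[OF c(1) X c(2)] by simp
    also have "\<dots> = (\<Sum>l<d. U $$ (i,l) * (X * V) $$ (l,j))"
      using c(1) XV ij(1,2) by (rule index_mult_mat_sum)
    also have "\<dots> = 0"
      using orth_on_mult_right[OF V X _ ij(2)] 0 ij by (intro sum.neutral) auto
    finally show ?thesis .
  qed
  show ?thesis
  proof (rule R_le_of_diag[OF bound orth_on_orth[OF U] orth_on_orth[OF V] X])
    fix i j assume ij: "i < d" "j < p" "i \<noteq> j \<or> r \<le> i"
    show "(U * X * V) $$ (i,j) = 0"
    proof (cases "i \<noteq> j \<and> j < r")
      case True
      then show ?thesis using diag ij by (simp add: diag_block_def del: index_mult_mat(1))
    next
      case False
      then have "r \<le> j" using ij by auto
      then show ?thesis using zero ij by blast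
    qed
  qed
qed

text \<open>Everything is real-valued here: \<open>\<phi>\<close> stands for a finite value of
  \<open>Phi_f\<close>, and \<open>M\<close> for an upper bound of the subgradient. The last
  conclusion is not divided by the smallest entry of \<open>\<theta>\<close>, which may be
  zero.\<close>

lemma error_decomposition:
  assumes bound: "\<And>\<delta>. \<delta> \<in> carrier_vec d \<Longrightarrow> l0_norm \<delta> \<le> r \<Longrightarrow> f \<delta> \<le> \<phi> * l2_norm \<delta>"
    and \<phi>: "0 \<le> \<phi>"
    and T: "T \<in> carrier_mat d p" and rank: "vec_space.rank d T \<le> r"
    and sub: "is_subgradient d f (sing_vals d p T) \<theta>"
    and D: "D \<in> carrier_mat d p" and le: "R (D + T) \<le> R T"
    and \<theta>0: "\<And>i. i < d \<Longrightarrow> 0 \<le> \<theta> $ i" and M: "\<And>i. i < d \<Longrightarrow> \<theta> $ i \<le> M" and M0: "0 \<le> M"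
  obtains \<delta> where "\<delta> \<in> carrier_vec d" "\<And>i. i < d \<Longrightarrow> 0 \<le> \<delta> $ i"
    "R D \<le> 2 * \<phi> * frob_norm D + f \<delta>"
    "l2_norm \<delta> \<le> frob_norm D"
    "(\<Sum>i<d. \<theta> $ i * \<delta> $ i) \<le> M * sqrt (real r) * frob_norm D"
proof -
  define s where "s = sing_vals d p T"
  define S where "S = rect_diag d p s"
  have sv: "is_sing_vals d p T s" unfolding s_def using T dp by (rule is_sing_vals_sing_vals)
  have s0: "s $ i = 0" if "r \<le> i" "i < d" for i
    using sing_vals_zero_beyond_rank[OF sv dp] rank that by auto
  obtain U0 V0 where U0: "orth_mat d U0" and V0: "orth_mat p V0" and T_eq: "T = U0 * S * V0"
    using sv by (auto simp: is_sing_vals_def S_def)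
  have s: "s \<in> carrier_vec d" using sv by (simp add: is_sing_vals_def)
  have S: "S \<in> carrier_mat d p" by (simp add: S_def)
  note c0 = orth_mat_carrier[OF orth_mat_transpose[OF U0]] orth_mat_carrier[OF orth_mat_transpose[OF V0]]
  define D1 where "D1 = transpose_mat U0 * D * transpose_mat V0"
  have UD: "transpose_mat U0 * D \<in> carrier_mat d p" using c0(1) D by (rule mult_carrier_mat)
  have D1: "D1 \<in> carrier_mat d p" unfolding D1_def using UD c0(2) by (rule mult_carrier_mat)
  \<comment> \<open>The block starts at \<open>r\<close> in rows and columns alike, away from the
    support of \<open>S\<close>, so \<open>S\<close> survives the rotation.\<close>
  obtain U1 V1 where U1: "orth_on d r d U1" and V1: "orth_on p r p V1"
    and diag: "diag_block r d p (U1 * D1 * V1)"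
    using block_svd[OF D1, of d p r] by auto
  note c1 = orth_mat_carrier[OF orth_on_orth[OF U1]] orth_mat_carrier[OF orth_on_orth[OF V1]]
  have U1S: "U1 * S = S"
    using s0 by (intro orth_on_mult_left_id[OF U1 S]) (auto simp: S_def rect_diag_def)
  have SV1: "S * V1 = S"
    using s0 by (intro orth_on_mult_right_id[OF V1 S]) (auto simp: S_def rect_diag_def)
  define U where "U = U1 * transpose_mat U0"
  define V where "V = transpose_mat V0 * V1"
  define Z where "Z = U * D * V"
  have U: "orth_mat d U" unfolding U_def
    using orth_on_orth[OF U1] orth_mat_transpose[OF U0] by (rule orth_mat_mult)
  have V: "orth_mat p V" unfolding V_def
    using orth_mat_transpose[OF V0] orth_on_orth[OF V1] by (rule orth_mat_mult)
  note cU = orth_mat_carrier[OF U] and cV = orth_mat_carrier[OF V]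
  have conj: "U * X * V = U1 * (transpose_mat U0 * X * transpose_mat V0) * V1"
    if X: "X \<in> carrier_mat d p" for X
  proof -
    have UX: "transpose_mat U0 * X \<in> carrier_mat d p" using c0(1) X by (rule mult_carrier_mat)
    have "U * X * V = U1 * (transpose_mat U0 * X) * (transpose_mat V0 * V1)"
      unfolding U_def V_def using assoc_mult_mat[OF c1(1) c0(1) X] by simp
    also have "\<dots> = U1 * (transpose_mat U0 * X) * transpose_mat V0 * V1"
      using assoc_mult_mat[OF mult_carrier_mat[OF c1(1) UX] c0(2) c1(2)] by simp
    also have "\<dots> = U1 * (transpose_mat U0 * X * transpose_mat V0) * V1"
      using assoc_mult_mat[OF c1(1) UX c0(2)] by simp
    finally show ?thesis .
  qed
  have Z_eq: "Z = U1 * D1 * V1" unfolding Z_def D1_def using D by (rule conj)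
  have "transpose_mat U0 * T * transpose_mat V0 = S"
    unfolding T_eq by (rule orth_mat_cancel[OF U0 V0 S])
  then have UTV: "U * T * V = S"
    using conj[OF T] by (simp add: U1S SV1)
  have Z: "Z \<in> carrier_mat d p"
    unfolding Z_def using mult_carrier_mat[OF cU D] cV by (rule mult_carrier_mat)
  have "U * (D + T) * V = Z + S"
    unfolding Z_def UTV[symmetric] using mult_add_distrib_mat[OF cU D T]
      add_mult_distrib_mat[OF mult_carrier_mat[OF cU D] mult_carrier_mat[OF cU T] cV] by simp
  then have RZS: "R (Z + S) \<le> f s"
    using R_orth[OF U V, of "D + T"] D T le R_eq by (simp add: s_def)
  have frob: "frob_norm Z = frob_norm D" unfolding Z_def by (rule frob_norm_orth[OF U V D])
  define y where "y = vec d (\<lambda>i. (Z + S) $$ (i,i))"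
  have y: "y \<in> carrier_vec d" by (simp add: y_def)
  have y_index: "y $ i = Z $$ (i,i) + s $ i" if "i < d" for i
    using that dp S Z by (simp add: y_def) (simp add: S_def rect_diag_index)
  \<comment> \<open>As \<open>y\<close> is the diagonal of \<open>Z + S\<close>, pinching gives
    \<open>f y \<le> R (Z + S)\<close>.\<close>
  have "f y \<le> f s"
    using norm_diagonal_le[OF norm inv add_carrier_mat[OF S] dp, of Z] RZS R_rect_diag[OF y]
    by (simp add: y_def)
  \<comment> \<open>The subgradient inequality at \<open>s\<close>, tested at \<open>y\<close>,
    reads \<open>f s + \<theta> \<bullet> (y - s) \<le> f y \<le> f s\<close>.\<close>
  then have "\<theta> \<bullet> (y - s) \<le> 0"
    using sub y by (force simp: is_subgradient_def s_def[symmetric])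
  moreover have "\<theta> \<bullet> (y - s) = (\<Sum>i<d. \<theta> $ i * Z $$ (i,i))"
    using s y_index by (auto simp: scalar_prod_def atLeast0LessThan intro!: sum.cong)
  ultimately have tr: "(\<Sum>i<d. \<theta> $ i * Z $$ (i,i)) \<le> 0" by simp
  \<comment> \<open>The zeros in front make \<open>rect_diag d p \<delta>\<close> the lower right
    block of \<open>Z\<close> in its original position.\<close>
  define \<delta> where "\<delta> = vec d (\<lambda>i. if r \<le> i then Z $$ (i,i) else 0)"
  have \<delta>: "\<delta> \<in> carrier_vec d" by (simp add: \<delta>_def)
  have \<delta>0: "0 \<le> \<delta> $ i" if "i < d" for i
    using that diag dp by (auto simp: \<delta>_def diag_block_def Z_eq[symmetric])
  define Z1 where "Z1 = mat d p (\<lambda>(i,j). if i < r then Z $$ (i,j) else 0)"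
  define Z2 where "Z2 = mat d p (\<lambda>(i,j). if r \<le> i \<and> j < r then Z $$ (i,j) else 0)"
  have Z12: "Z1 \<in> carrier_mat d p" "Z2 \<in> carrier_mat d p" by (auto simp: Z1_def Z2_def)
  \<comment> \<open>The leading rows, the rest of the leading columns and the diagonal block cover
    each entry of \<open>Z\<close> once.\<close>
  have Z_sum: "Z = Z1 + (Z2 + rect_diag d p \<delta>)"
    using Z diag by (intro eq_matI)
      (auto simp: Z1_def Z2_def rect_diag_def \<delta>_def diag_block_def Z_eq[symmetric])
  have "R Z \<le> R Z1 + (R Z2 + R (rect_diag d p \<delta>))"
    unfolding Z_sum using Z12
      mat_norm_onD(3)[OF norm Z12(1), of "Z2 + rect_diag d p \<delta>"]
      mat_norm_onD(3)[OF norm Z12(2), of "rect_diag d p \<delta>"] by simp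
  moreover have "R Z1 \<le> \<phi> * frob_norm Z1"
    by (rule R_le_few_rows[OF bound Z12(1)]) (auto simp: Z1_def)
  moreover have "R Z2 \<le> \<phi> * frob_norm Z2"
    by (rule R_le_few_cols[OF bound Z12(2)]) (auto simp: Z2_def)
  moreover have "frob_norm Z1 \<le> frob_norm Z" "frob_norm Z2 \<le> frob_norm Z"
    using Z Z12 by (auto intro!: frob_norm_mono simp: Z1_def Z2_def)
  then have "\<phi> * frob_norm Z1 \<le> \<phi> * frob_norm Z" "\<phi> * frob_norm Z2 \<le> \<phi> * frob_norm Z"
    using \<phi> by (auto intro: mult_left_mono)
  moreover have "R Z = R D" unfolding Z_def by (rule R_orth[OF U V D])
  ultimately have RD: "R D \<le> 2 * \<phi> * frob_norm D + f \<delta>"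
    unfolding frob R_rect_diag[OF \<delta>] by linarith
  have l2: "l2_norm x \<le> frob_norm D"
    if "x \<in> carrier_vec d" "\<And>i. i < d \<Longrightarrow> \<bar>x $ i\<bar> \<le> \<bar>Z $$ (i,i)\<bar>" for x
    unfolding frob_norm_rect_diag[OF dp that(1), symmetric] frob[symmetric]
    using Z that by (intro frob_norm_mono) (auto simp: rect_diag_def)
  \<comment> \<open>\<open>\<delta>\<close> differs from the diagonal of \<open>Z\<close> only at
    indices below \<open>r\<close>; once the nonpositive term \<open>tr\<close> is dropped, only
    these entries remain to be bounded.\<close>
  have "(\<Sum>i<d. \<theta> $ i * \<delta> $ i) = (\<Sum>i<d. \<theta> $ i * Z $$ (i,i)) + (\<Sum>i<d. if i < r then - (\<theta> $ i * Z $$ (i,i)) else 0)"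
    unfolding sum.distrib[symmetric] by (intro sum.cong) (auto simp: \<delta>_def)
  also have "\<dots> \<le> (\<Sum>i<d. if i < r then - (\<theta> $ i * Z $$ (i,i)) else 0)" using tr by simp
  also have "\<dots> \<le> (\<Sum>i<d. M * ((if i < r then 1 else 0) * \<bar>Z $$ (i,i)\<bar>))"
  proof (rule sum_mono)
    fix i assume "i \<in> {..<d}"
    then have "- (\<theta> $ i * Z $$ (i,i)) \<le> \<theta> $ i * \<bar>Z $$ (i,i)\<bar>" "\<theta> $ i * \<bar>Z $$ (i,i)\<bar> \<le> M * \<bar>Z $$ (i,i)\<bar>"
      using \<theta>0[of i] M[of i] mult_left_mono[of "- Z $$ (i,i)" "\<bar>Z $$ (i,i)\<bar>" "\<theta> $ i"]
      by (auto intro: mult_right_mono)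
    then show "(if i < r then - (\<theta> $ i * Z $$ (i,i)) else 0) \<le> M * ((if i < r then 1 else 0) * \<bar>Z $$ (i,i)\<bar>)"
      by auto
  qed
  also have "\<dots> = M * (\<Sum>i<d. (if i < r then 1 else 0) * \<bar>Z $$ (i,i)\<bar>)" by (simp add: sum_distrib_left)
  also have "\<dots> \<le> M * (sqrt (real r) * frob_norm D)"
  proof (rule mult_left_mono[OF _ M0])
    \<comment> \<open>Cauchy-Schwarz against the indicator of the indices below \<open>r\<close>
      produces the factor \<open>sqrt (real r)\<close>.\<close>
    have "(\<Sum>i<d. (if i < r then 1 else 0) * \<bar>Z $$ (i,i)\<bar>)\<^sup>2
        \<le> (\<Sum>i<d. (if i < r then 1 else 0 :: real)\<^sup>2) * (\<Sum>i<d. \<bar>Z $$ (i,i)\<bar>\<^sup>2)"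
      by (rule Cauchy_Schwarz_ineq_sum)
    also have "(\<Sum>i<d. (if i < r then 1 else 0 :: real)\<^sup>2) = real (card ({..<d} \<inter> {..<r}))"
      by (simp add: if_distrib[of "\<lambda>x. x\<^sup>2"] sum.If_cases lessThan_def Collect_conj_eq cong: if_cong)
    also have "real (card ({..<d} \<inter> {..<r})) * (\<Sum>i<d. \<bar>Z $$ (i,i)\<bar>\<^sup>2) \<le> real r * (\<Sum>i<d. \<bar>Z $$ (i,i)\<bar>\<^sup>2)"
      using card_mono[of "{..<r}" "{..<d} \<inter> {..<r}"]
      by (intro mult_right_mono sum_nonneg) auto
    finally have "(\<Sum>i<d. (if i < r then 1 else 0) * \<bar>Z $$ (i,i)\<bar>) \<le> sqrt (real r) * sqrt (\<Sum>i<d. (Z $$ (i,i))\<^sup>2)"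
      unfolding real_sqrt_mult[symmetric] by (intro real_le_rsqrt) simp
    also have "sqrt (\<Sum>i<d. (Z $$ (i,i))\<^sup>2) = l2_norm (vec d (\<lambda>i. Z $$ (i,i)))"
      by (simp add: l2_norm_def)
    also have "sqrt (real r) * \<dots> \<le> sqrt (real r) * frob_norm D"
      by (intro mult_left_mono l2) auto
    finally show "(\<Sum>i<d. (if i < r then 1 else 0) * \<bar>Z $$ (i,i)\<bar>) \<le> sqrt (real r) * frob_norm D" .
  qed
  finally have "(\<Sum>i<d. \<theta> $ i * \<delta> $ i) \<le> M * sqrt (real r) * frob_norm D" by (simp add: mult.assoc)
  moreover have "l2_norm \<delta> \<le> frob_norm D" using \<delta> by (intro l2) (auto simp: \<delta>_def)
  ultimately show thesis using that[OF \<delta> \<delta>0 RD] by blast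
qed

end

section \<open>The bound on the error cone\<close>

theorem theorem3:
  fixes d p r :: nat and R :: "real mat \<Rightarrow> real" and f :: "real vec \<Rightarrow> real"
    and \<eta>1 \<eta>2 :: real and Ts :: "real mat" and \<theta> :: "real vec"
  assumes "d \<le> p"
    and "mat_norm_on d p R"
    and "unitarily_invariant d p R"
    and "symmetric_gauge d f"
    and "\<forall>X\<in>carrier_mat d p. R X = f (sing_vals d p X)"
    and "0 \<le> \<eta>1" and "0 \<le> \<eta>2"
    and "\<forall>\<delta>\<in>carrier_vec d. f \<delta> \<le> max (\<eta>1 * l1_norm \<delta>) (\<eta>2 * l2_norm \<delta>)"
    and "Ts \<in> carrier_mat d p"
    and "vec_space.rank d Ts = r"
    and "0 < r"
    and "is_subgradient d f (sing_vals d p Ts) \<theta>"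
    and "\<forall>i<d. 0 \<le> \<theta> $ i"
    and "\<forall>i j. i \<le> j \<longrightarrow> j < d \<longrightarrow> \<theta> $ j \<le> \<theta> $ i"
  shows "Psi_R d p R Ts \<le> 2 * Phi_f d f r
           + max (ereal \<eta>2) (ereal \<eta>1 * (1 + rho_ratio d \<theta>) * ereal (sqrt (real r)))"
proof -
  interpret unitarily_invariant_norm d p R f by unfold_locales fact+
  define C where "C = max (ereal \<eta>2) (ereal \<eta>1 * (1 + rho_ratio d \<theta>) * ereal (sqrt (real r)))"
  have C0: "0 \<le> C" using assms(7) by (simp add: C_def max.coboundedI1)
  have f0: "0 \<le> f x" if "x \<in> carrier_vec d" for x
    using gauge that by (auto simp: symmetric_gauge_def vec_norm_on_def)
  have f_zero: "f (0\<^sub>v d) = 0"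
    using gauge zero_carrier_vec[of d] unfolding symmetric_gauge_def vec_norm_on_def by blast
  have "ereal (R D / frob_norm D) \<le> 2 * Phi_f d f r + C"
    if D_cone: "D \<in> err_cone d p R Ts" and D_nz: "D \<noteq> 0\<^sub>m d p" for D
  proof -
    \<comment> \<open>The scaling \<open>t\<close> of the cone cancels in the quotient, so it
      suffices to treat \<open>E\<close>.\<close>
    obtain t E where t: "0 \<le> t" "D = t \<cdot>\<^sub>m E" and E: "E \<in> carrier_mat d p" and le: "R (E + Ts) \<le> R Ts"
      using D_cone by (auto simp: err_cone_def)
    have t_pos: "0 < t" using t D_nz E by (cases "t = 0") (auto intro!: eq_matI)
    have E_nz: "E \<noteq> 0\<^sub>m d p" using t D_nz by auto
    have FE: "0 < frob_norm E"
      using frob_norm_nonneg[of E] frob_norm_eq_0_iff[OF E] E_nz by linarith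
    have ratio: "R D / frob_norm D = R E / frob_norm E"
      using mat_norm_onD(2)[OF norm E E, of t] frob_norm_smult[OF E, of t] t t_pos by simp
    \<comment> \<open>With \<open>d = 0\<close> the matrix \<open>E\<close> would be zero.
      Positivity keeps \<open>vmax\<close> and \<open>vmin\<close> from ranging over an empty
      set.\<close>
    have d: "0 < d" using E E_nz by (cases "d = 0") (auto intro!: eq_matI)
    have Phi_ge: "ereal (f \<delta> / l2_norm \<delta>) \<le> Phi_f d f r"
      if "\<delta> \<in> carrier_vec d" "\<delta> \<noteq> 0\<^sub>v d" "l0_norm \<delta> \<le> r" for \<delta>
      unfolding Phi_f_def using that by (intro Sup_upper) blast
    \<comment> \<open>A supremum over the empty set would be negative infinity in
      \<open>ereal\<close>; since \<open>0 < r\<close>, the first unit vector is admissible.\<close>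
    have Phi0: "0 \<le> Phi_f d f r"
    proof -
      have "{i. i < d \<and> unit_vec d 0 $ i \<noteq> (0::real)} = {0}" using d by (auto split: if_splits)
      then have "l0_norm (unit_vec d 0) \<le> r" using assms(11) by (simp add: l0_norm_def)
      moreover have "unit_vec d 0 \<noteq> (0\<^sub>v d :: real vec)"
        using d by (metis index_unit_vec(1) index_zero_vec(1) zero_neq_one)
      ultimately have "ereal (f (unit_vec d 0) / l2_norm (unit_vec d 0)) \<le> Phi_f d f r"
        by (intro Phi_ge) auto
      moreover have "0 \<le> f (unit_vec d 0) / l2_norm (unit_vec d 0)"
        using f0 by (simp add: l2_norm_def sum_nonneg)
      ultimately show ?thesis by (meson ereal_less_eq(5) order_trans)
    qed
    show ?thesis
    \<comment> \<open>As both terms are nonnegative, an infinite one makes the claim trivial.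
      Otherwise the computation takes place in the reals.\<close>
    proof (cases "Phi_f d f r = \<infinity> \<or> C = \<infinity>")
      case True
      then show ?thesis using Phi0 C0 by (auto simp: ereal_mult_infty)
    next
      case False
      then obtain \<phi> c where \<phi>: "Phi_f d f r = ereal \<phi>" and c: "C = ereal c"
        using Phi0 C0 by (cases "Phi_f d f r"; cases C) auto
      have \<phi>0: "0 \<le> \<phi>" using Phi0 \<phi> by simp
      \<comment> \<open>The zero vector is excluded from the supremum and is treated apart.\<close>
      have bound: "f \<delta> \<le> \<phi> * l2_norm \<delta>" if \<delta>: "\<delta> \<in> carrier_vec d" "l0_norm \<delta> \<le> r" for \<delta>
      proof (cases "\<delta> = 0\<^sub>v d")
        case True
        then show ?thesis by (simp add: f_zero l2_norm_def)
      next
        case nz: False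
        have "\<exists>i<d. \<delta> $ i \<noteq> 0"
        proof (rule ccontr)
          assume "\<not> ?thesis"
          then have "\<delta> = 0\<^sub>v d" using \<delta> by (intro eq_vecI) auto
          then show False using nz by contradiction
        qed
        then obtain i where "i < d" "\<delta> $ i \<noteq> 0" by blast
        then have "0 < (\<Sum>i<d. (\<delta> $ i)\<^sup>2)" by (intro sum_pos2[of _ i]) auto
        then have "0 < l2_norm \<delta>" using \<delta> by (simp add: l2_norm_def)
        then show ?thesis using Phi_ge[OF \<delta>(1) nz \<delta>(2)] by (simp add: \<phi> pos_divide_le_eq)
      qed
      have vmax: "\<theta> $ i \<le> vmax d \<theta>" and vmin: "vmin d \<theta> \<le> \<theta> $ i" if "i < d" for i
        using that unfolding vmax_def vmin_def by (intro Max_ge Min_le; force)+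
      have vmin0: "0 \<le> vmin d \<theta>"
        unfolding vmin_def using d assms(13) by (subst Min_ge_iff) auto
      have vmax0: "0 \<le> vmax d \<theta>" using vmax[OF d] assms(13) d by fastforce
      obtain \<delta> where \<delta>: "\<delta> \<in> carrier_vec d" "\<And>i. i < d \<Longrightarrow> 0 \<le> \<delta> $ i"
        and RE: "R E \<le> 2 * \<phi> * frob_norm E + f \<delta>"
        and l2: "l2_norm \<delta> \<le> frob_norm E"
        and l1: "(\<Sum>i<d. \<theta> $ i * \<delta> $ i) \<le> vmax d \<theta> * sqrt (real r) * frob_norm E"
        using error_decomposition[OF bound \<phi>0 assms(9) _ assms(12) E le _ vmax vmax0] assms(10,13) by auto
      have "f \<delta> \<le> c * frob_norm E"
      proof -
        have c2: "\<eta>2 \<le> c" using c unfolding C_def by (metis ereal_less_eq(3) max.cobounded1)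
        have 2: "\<eta>2 * l2_norm \<delta> \<le> c * frob_norm E"
          using c2 l2 assms(7) FE by (intro mult_mono) (auto simp: l2_norm_def sum_nonneg)
        \<comment> \<open>For \<open>\<eta>1 = 0\<close> the ratio may be infinite, but the left
          side vanishes and \<open>c\<close> is nonnegative. For \<open>\<eta>1\<close> nonzero,
          finiteness of \<open>C\<close> excludes \<open>vmin d \<theta> = 0\<close>.\<close>
        have 1: "\<eta>1 * l1_norm \<delta> \<le> c * frob_norm E"
        proof (cases "\<eta>1 = 0")
          case True
          then show ?thesis using c2 assms(7) FE by simp
        next
          case \<eta>: False
          have "vmin d \<theta> \<noteq> 0"
          proof
            assume "vmin d \<theta> = 0"
            then have "C = \<infinity>"
              using \<eta> assms(6,11) by (simp add: C_def rho_ratio_def max_def)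
            then show False using c by simp
          qed
          then have pos: "0 < vmin d \<theta>" using vmin0 by simp
          define \<rho> where "\<rho> = vmax d \<theta> / vmin d \<theta>"
          have \<rho>: "rho_ratio d \<theta> = ereal \<rho>" using pos by (simp add: rho_ratio_def \<rho>_def)
          have c1: "\<eta>1 * (1 + \<rho>) * sqrt (real r) \<le> c"
          proof -
            have "ereal (\<eta>1 * (1 + \<rho>) * sqrt (real r)) \<le> C" unfolding C_def \<rho> by (simp add: one_ereal_def)
            then show ?thesis using c by simp
          qed
          \<comment> \<open>Since \<open>\<delta>\<close> is nonnegative, its l1 norm is a plain
            sum, comparable with the weighted sum in \<open>l1\<close>.\<close>
          have "vmin d \<theta> * l1_norm \<delta> = (\<Sum>i<d. vmin d \<theta> * \<delta> $ i)"
            using \<delta> by (simp add: l1_norm_def sum_distrib_left)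
          also have "\<dots> \<le> (\<Sum>i<d. \<theta> $ i * \<delta> $ i)"
            using \<delta> vmin by (intro sum_mono mult_right_mono) auto
          also have "\<dots> \<le> vmax d \<theta> * sqrt (real r) * frob_norm E" by (rule l1)
          finally have "l1_norm \<delta> \<le> \<rho> * sqrt (real r) * frob_norm E"
            using pos by (simp add: \<rho>_def field_simps)
          \<comment> \<open>The factor \<open>\<rho>\<close> is enlarged to the
            \<open>1 + \<rho>\<close> that occurs in \<open>C\<close>.\<close>
          also have "\<dots> \<le> (1 + \<rho>) * sqrt (real r) * frob_norm E"
            using FE by (intro mult_right_mono) auto
          finally have "\<eta>1 * l1_norm \<delta> \<le> \<eta>1 * ((1 + \<rho>) * sqrt (real r) * frob_norm E)"
            using assms(6) by (rule mult_left_mono)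
          also have "\<dots> = \<eta>1 * (1 + \<rho>) * sqrt (real r) * frob_norm E" by (simp add: mult.assoc)
          also have "\<dots> \<le> c * frob_norm E" using c1 FE by (intro mult_right_mono) auto
          finally show ?thesis .
        qed
        show ?thesis using assms(8) \<delta>(1) 1 2 by fastforce
      qed
      then have "R E \<le> (2 * \<phi> + c) * frob_norm E" using RE by (simp add: algebra_simps)
      then have "R E / frob_norm E \<le> 2 * \<phi> + c" using FE by (simp add: pos_divide_le_eq)
      moreover have "2 * Phi_f d f r + C = ereal (2 * \<phi> + c)"
        unfolding \<phi> c by (simp add: numeral_eq_ereal)
      ultimately show ?thesis using ratio by simp
    qed
  qed
  then show ?thesis unfolding Psi_R_def C_def by (intro Sup_least) blast
qed

end
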